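(* Let $J\subsetneq I\subset S=K[x_1,\ldots,x_n]$ be monomial ideals, let $g$ and the characteristic poset $P^g_{I/J}$ be as in the context, and let $\mathcal{D}$ be a Stanley decomposition of $I/J$ induced by a prime filtration of $I/J$. Then there exists a partition $\mathcal{P}$ of $P^g_{I/J}$ into intervals with the property that $\mathcal{D}(\mathcal{P})$ is induced by a prime filtration and such that $\operatorname{sdepth}\mathcal{D}(\mathcal{P})\ge\operatorname{sdepth}\mathcal{D}$.
   Context: $K$ is a field and $S=K[x_1,\ldots,x_n]$ with its $\mathbb{Z}^n$-grading. For a finitely generated $\mathbb{Z}^n$-graded $S$-module $M$, a homogeneous $u\in M$ and $Z\subset\{x_1,\ldots,x_n\}$, $uK[Z]$ denotes the $K$-subspace of $M$ generated by all $uv$ with $v$ a monomial in $K[Z]$; it is a Stanley space of dimension $|Z|$ if it is a free $K[Z]$-module. A Stanley decomposition of $M$ is a presentation $\mathcal{D}: M=\bigoplus_{i=1}^m u_iK[Z_i]$ of $M$ as a finite direct sum of Stanley spaces, as $\mathbb{Z}^n$-graded $K$-vector spaces; $\operatorname{sdepth}\mathcal{D}=\min\{|Z_i|\}$. A prime filtration of $M$ is a chain of $\mathbb{Z}^n$-graded submodules $0=M_0\subset M_1\subset\cdots\subset M_m=M$ with $M_i/M_{i-1}\cong(S/P_i)(-a_i)$, $a_i\in\mathbb{Z}^n$, $P_i$ a monomial prime ideal. It gives rise to Stanley decompositions $M=\bigoplus_{i=1}^m u_iK[Z_i]$, where $u_i\in M_i$ is homogeneous of degree $a_i$ with residue class generating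 $M_i/M_{i-1}$ and $Z_i=\{x_j: x_j\notin P_i\}$; a Stanley decomposition is said to be induced by a prime filtration if, after renumbering its summands, it arises in this way. For $a\in\mathbb{N}^n$ (with $0\in\mathbb{N}$), $x^a=x_1^{a(1)}\cdots x_n^{a(n)}$; $\mathbb{N}^n$ is partially ordered componentwise. Let $I$ be generated by monomials $x^{a_1},\ldots,x^{a_t}$ and $J$ by monomials $x^{b_1},\ldots,x^{b_s}$ (no $b_j$'s if $J=0$). Fix $g\in\mathbb{N}^n$ with $a_i\le g$ and $b_j\le g$ for all $i,j$. The characteristic poset of $I/J$ with respect to $g$ is $P^g_{I/J}=\{c\in\mathbb{N}^n: c\le g,\ a_i\le c \text{ for some } i,\ c\not\ge b_j\text{ for all } j\}$, a finite subposet of $\mathbb{N}^n$. For $a\le b$ in a poset $P$, $[a,b]=\{c\in P: a\le c\le b\}$ is an interval; a partition of a finite poset $P$ is a presentation $P=\bigcup_{i=1}^r[a_i,b_i]$ as a disjoint union of (nonempty) intervals. For $b\in P^g_{I/J}$ set $Z_b=\{x_j: b(j)=g(j)\}$. The module $I/J$ is identified with the $K$-span of the monomials in $I\setminus J$. A partition $\mathcal{P}: P^g_{I/J}=\bigcup_{i=1}^r[c_i,d_i]$ gives the Stanley decomposition $\mathcal{D}(\mathcal{P}): I/J=\bigoplus_{i=1}^r\big(\bigoplus_c x^cK[Z_{d_i}]\big)$, where the inner sum is over all $c\in[c_i,d_i]$ with $c(j)=c_i(j)$ for all $j$ with $x_j\in Z_{d_i}$. *)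

theory Defs
  imports
    "HOL-Library.Poly_Mapping"
    "HOL-Library.Function_Algebras"
    "HOL-Library.Disjoint_Sets"
    "HOL-Algebra.Module"
    "HOL-Algebra.QuotRing"
    "HOL-Algebra.Algebraic_Closure_Type"
begin

section \<open>The polynomial ring\<close>

text \<open>
  The (finite) type \<open>'n\<close> indexes the variables.  Exponents are functions \<open>'n \<Rightarrow> nat\<close>, so that
  \<open>\<le>\<close> and \<open>{c..d}\<close> on them are componentwise (the order that \<open>\<Rightarrow>\<^sub>0\<close> carries in the library is a
  lexicographic one).  Multidegrees are functions \<open>'n \<Rightarrow> int\<close>.
\<close>

type_synonym ('n, 'k) mpoly = "('n \<Rightarrow> nat) \<Rightarrow>\<^sub>0 'k"

abbreviation mpoly_ring :: "('n, 'k::field) mpoly ring" where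
  "mpoly_ring \<equiv> ring_of_type_algebra"

definition xpow :: "('n \<Rightarrow> nat) \<Rightarrow> ('n, 'k::field) mpoly" where
  "xpow c = Poly_Mapping.single c 1"

definition xvar :: "'n \<Rightarrow> ('n, 'k::field) mpoly" where
  "xvar j = xpow (\<lambda>i. if i = j then 1 else 0)"

definition scalar :: "'k::field \<Rightarrow> ('n, 'k) mpoly" where
  "scalar k = Poly_Mapping.single 0 k"

definition exps :: "'n set \<Rightarrow> ('n \<Rightarrow> nat) set" where
  "exps Z = {v. \<forall>j. j \<notin> Z \<longrightarrow> v j = 0}"

text \<open>The subring \<open>K[Z]\<close>.\<close>
definition subpoly :: "'n set \<Rightarrow> ('n, 'k::field) mpoly set" where
  "subpoly Z = {f. Poly_Mapping.keys f \<subseteq> exps Z}"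

definition monomial_ideal :: "('n, 'k::field) mpoly set \<Rightarrow> bool" where
  "monomial_ideal I \<longleftrightarrow> (\<exists>A. I = Idl\<^bsub>mpoly_ring\<^esub> (xpow ` A))"


section \<open>Graded modules over the polynomial ring\<close>

text \<open>\<open>hcomp M a\<close> is the homogeneous component of degree \<open>a\<close>.  As in any \<open>module\<close> record, the
  fields \<open>mult\<close> and \<open>one\<close> play no role.\<close>
record ('a, 'b, 'n) gmodule = "('a, 'b) module" +
  hcomp :: "('n \<Rightarrow> int) \<Rightarrow> 'b set"

definition poly_gmodule :: "(('n, 'k::field) mpoly, ('n, 'k) mpoly, 'n) gmodule" where
  "poly_gmodule =
    \<lparr>carrier = UNIV, monoid.mult = (*), one = 1, zero = 0, add = (+), module.smult = (*),
     hcomp = (\<lambda>a. {p. \<forall>v \<in> Poly_Mapping.keys p. (\<lambda>j. int (v j)) = a})\<rparr>"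

definition gsub :: "('a, 'b, 'n) gmodule \<Rightarrow> 'b set \<Rightarrow> ('a, 'b, 'n) gmodule" where
  "gsub M N = M\<lparr>carrier := N, hcomp := (\<lambda>a. hcomp M a \<inter> N)\<rparr>"

definition gquot :: "('a, 'b, 'n) gmodule \<Rightarrow> 'b set \<Rightarrow> ('a, 'b set, 'n) gmodule" where
  "gquot M N =
    \<lparr>carrier = a_rcosets\<^bsub>M\<^esub> N, monoid.mult = undefined, one = undefined,
     zero = N, add = set_add M,
     module.smult = (\<lambda>r C. \<Union>x\<in>C. N +>\<^bsub>M\<^esub> (r \<odot>\<^bsub>M\<^esub> x)),
     hcomp = (\<lambda>a. (\<lambda>x. N +>\<^bsub>M\<^esub> x) ` hcomp M a)\<rparr>"

text \<open>The shifted module \<open>M(a)\<close>, with \<open>M(a)\<^sub>b = M\<^bsub>a+b\<^esub>\<close>.\<close>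
definition gshift :: "('a, 'b, 'n) gmodule \<Rightarrow> ('n \<Rightarrow> int) \<Rightarrow> ('a, 'b, 'n) gmodule" where
  "gshift M a = M\<lparr>hcomp := (\<lambda>b. hcomp M (a + b))\<rparr>"

definition giso ::
  "(('n, 'k::field) mpoly, 'b, 'n) gmodule \<Rightarrow> (('n, 'k) mpoly, 'c, 'n) gmodule \<Rightarrow> bool" where
  "giso M N \<longleftrightarrow> (\<exists>h. bij_betw h (carrier M) (carrier N)
     \<and> (\<forall>x\<in>carrier M. \<forall>y\<in>carrier M. h (x \<oplus>\<^bsub>M\<^esub> y) = h x \<oplus>\<^bsub>N\<^esub> h y)
     \<and> (\<forall>r. \<forall>x\<in>carrier M. h (r \<odot>\<^bsub>M\<^esub> x) = r \<odot>\<^bsub>N\<^esub> h x)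
     \<and> (\<forall>b. h ` hcomp M b = hcomp N b))"

text \<open>A submodule is graded if each of its elements is a finite sum of homogeneous elements
  that themselves lie in the submodule.\<close>
definition graded_submodule ::
  "(('n, 'k::field) mpoly, 'b, 'n) gmodule \<Rightarrow> 'b set \<Rightarrow> bool" where
  "graded_submodule M N \<longleftrightarrow> submodule N mpoly_ring M
     \<and> (\<forall>x\<in>N. \<exists>A y. finite A \<and> (\<forall>a\<in>A. y a \<in> hcomp M a \<inter> N) \<and> x = (\<Oplus>\<^bsub>M\<^esub>a\<in>A. y a))"

definition generated_by ::
  "(('n, 'k::field) mpoly, 'b, 'n) gmodule \<Rightarrow> 'b \<Rightarrow> bool" where
  "generated_by M w \<longleftrightarrow> w \<in> carrier M \<and> carrier M = {r \<odot>\<^bsub>M\<^esub> w | r. True}"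


section \<open>Stanley decompositions\<close>

definition K_span ::
  "(('n, 'k::field) mpoly, 'b, 'n) gmodule \<Rightarrow> 'b set \<Rightarrow> 'b set" where
  "K_span M G = {(\<Oplus>\<^bsub>M\<^esub>x\<in>F. scalar (k x) \<odot>\<^bsub>M\<^esub> x) | F k. finite F \<and> F \<subseteq> G}"

definition uK ::
  "(('n, 'k::field) mpoly, 'b, 'n) gmodule \<Rightarrow> 'b \<Rightarrow> 'n set \<Rightarrow> 'b set" where
  "uK M u Z = K_span M {xpow v \<odot>\<^bsub>M\<^esub> u | v. v \<in> exps Z}"

text \<open>The \<open>K[Z]\<close>-module \<open>u K[Z]\<close> is generated by \<open>u\<close>; freeness means that \<open>u\<close> is a basis, which
  forces \<open>u \<noteq> 0\<close>.\<close>
definition stanley_space ::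
  "(('n, 'k::field) mpoly, 'b, 'n) gmodule \<Rightarrow> 'b \<Rightarrow> 'n set \<Rightarrow> bool" where
  "stanley_space M u Z \<longleftrightarrow> (\<exists>a. u \<in> hcomp M a)
     \<and> (\<forall>f\<in>subpoly Z. f \<odot>\<^bsub>M\<^esub> u = \<zero>\<^bsub>M\<^esub> \<longrightarrow> f = 0)"

text \<open>A decomposition is given by the finite set of its pairs \<open>(u, Z)\<close>.  A set suffices: the
  summands are nonzero and independent, so no pair can occur twice.\<close>
definition stanley_decomposition ::
  "(('n, 'k::field) mpoly, 'b, 'n) gmodule \<Rightarrow> ('b \<times> 'n set) set \<Rightarrow> bool" where
  "stanley_decomposition M D \<longleftrightarrow> finite D
     \<and> (\<forall>(u, Z)\<in>D. stanley_space M u Z \<and> uK M u Z \<subseteq> carrier M)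
     \<and> (\<forall>x\<in>carrier M. \<exists>!w. w \<in> (\<Pi>\<^sub>E p\<in>D. uK M (fst p) (snd p)) \<and> x = (\<Oplus>\<^bsub>M\<^esub>p\<in>D. w p))"

definition sdepth :: "('b \<times> 'n set) set \<Rightarrow> nat" where
  "sdepth D = Min ((\<lambda>(u, Z). card Z) ` D)"


section \<open>Prime filtrations\<close>

definition prime_filtration ::
  "(('n, 'k::field) mpoly, 'b, 'n) gmodule \<Rightarrow> nat \<Rightarrow> (nat \<Rightarrow> 'b set)
    \<Rightarrow> (nat \<Rightarrow> ('n, 'k) mpoly set) \<Rightarrow> (nat \<Rightarrow> 'n \<Rightarrow> int) \<Rightarrow> bool" where
  "prime_filtration M m F P a \<longleftrightarrow> F 0 = {\<zero>\<^bsub>M\<^esub>} \<and> F m = carrier M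
     \<and> (\<forall>i\<le>m. graded_submodule M (F i))
     \<and> (\<forall>i<m. F i \<subset> F (Suc i)
          \<and> primeideal (P i) mpoly_ring \<and> monomial_ideal (P i)
          \<and> giso (gquot (gsub M (F (Suc i))) (F i)) (gshift (gquot poly_gmodule (P i)) (- a i)))"

text \<open>The filtration step with index \<open>i < m\<close> is the passage from \<open>F i\<close> to \<open>F (Suc i)\<close>;
  the bijection accounts for the renumbering of the summands.\<close>
definition induced_by_prime_filtration ::
  "(('n, 'k::field) mpoly, 'b, 'n) gmodule \<Rightarrow> ('b \<times> 'n set) set \<Rightarrow> bool" where
  "induced_by_prime_filtration M D \<longleftrightarrow> (\<exists>m F P a u Z. prime_filtration M m F P a
     \<and> bij_betw (\<lambda>i. (u i, Z i)) {..<m} D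
     \<and> (\<forall>i<m. u i \<in> F (Suc i) \<and> u i \<in> hcomp M (a i)
          \<and> generated_by (gquot (gsub M (F (Suc i))) (F i)) (F i +>\<^bsub>M\<^esub> u i)
          \<and> Z i = {j. xvar j \<notin> P i}))"


section \<open>The characteristic poset and its partitions\<close>

definition char_poset ::
  "('n \<Rightarrow> nat) set \<Rightarrow> ('n \<Rightarrow> nat) set \<Rightarrow> ('n \<Rightarrow> nat) \<Rightarrow> ('n \<Rightarrow> nat) set" where
  "char_poset A B g = {c. c \<le> g \<and> (\<exists>a\<in>A. a \<le> c) \<and> (\<forall>b\<in>B. \<not> b \<le> c)}"

text \<open>A partition is given by the set of endpoint pairs of its intervals.\<close>
definition interval_partition :: "'p::order set \<Rightarrow> ('p \<times> 'p) set \<Rightarrow> bool" where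
  "interval_partition P Q \<longleftrightarrow> finite Q
     \<and> (\<forall>(c, d)\<in>Q. c \<in> P \<and> d \<in> P \<and> c \<le> d)
     \<and> disjoint_family_on (\<lambda>(c, d). {c..d} \<inter> P) Q
     \<and> P = (\<Union>(c, d)\<in>Q. {c..d} \<inter> P)"

definition Zset :: "('n \<Rightarrow> nat) \<Rightarrow> ('n \<Rightarrow> nat) \<Rightarrow> 'n set" where
  "Zset g b = {j. b j = g j}"

text \<open>The module \<open>I/J\<close>; the monomial \<open>x\<^sup>c\<close> in it is the coset \<open>J + x\<^sup>c\<close>.\<close>
definition ideal_quot ::
  "('n, 'k::field) mpoly set \<Rightarrow> ('n, 'k) mpoly set
    \<Rightarrow> (('n, 'k) mpoly, ('n, 'k) mpoly set, 'n) gmodule" where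
  "ideal_quot I J = gquot (gsub poly_gmodule I) J"

text \<open>The decomposition \<open>\<D>(\<P>)\<close>.  Intervals of the characteristic poset are intervals of the
  ambient order, as the poset is convex.\<close>
definition partition_decomposition ::
  "('n, 'k::field) mpoly set \<Rightarrow> ('n \<Rightarrow> nat) \<Rightarrow> (('n \<Rightarrow> nat) \<times> ('n \<Rightarrow> nat)) set
    \<Rightarrow> (('n, 'k) mpoly set \<times> 'n set) set" where
  "partition_decomposition J g Q =
     {(J +>\<^bsub>poly_gmodule\<^esub> xpow c, Zset g d) | c e d.
        (e, d) \<in> Q \<and> c \<in> {e..d} \<and> (\<forall>j\<in>Zset g d. c j = e j)}"

end

theory Submission
  imports Defs
begin

text \<open>
  Write \<open>E\<close> for the set of exponents of the monomials in \<open>I - J\<close>. A prime filtration of \<open>I/J\<close> that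
  induces a Stanley decomposition is the same thing as an enumeration of cones \<open>c + \<nat>\<^sup>Z\<close> that are disjoint
  with union \<open>E\<close>, such that every initial union \<open>U\<close> is closed in \<open>E\<close> under adding exponents: the
  colon ideal of a step is automatically generated by the variables outside \<open>Z\<close>, since \<open>U\<close> together
  with the new cone is closed and the new cone is disjoint from \<open>U\<close>. As the generators of \<open>I\<close> and \<open>J\<close> are bounded by \<open>g\<close>,
  membership of \<open>b\<close> in \<open>E\<close> depends only on \<open>inf b g\<close>. Pulling the chain of unions \<open>U\<close> back along \<open>b \<mapsto> inf b g\<close>
  gives again closed subsets of \<open>E\<close>; a cone with \<open>c \<le> g\<close> pulls back to the cone with \<open>Z\<close> enlarged by
  the \<open>j\<close> with \<open>c j = g j\<close>, and all other cones pull back to the empty set. The cones with \<open>c \<le> g\<close> meet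
  the box below \<open>g\<close> in intervals, and the enlarged cones are the Stanley spaces of that partition.
\<close>

section \<open>Polynomials with prescribed support\<close>

abbreviation keys :: "('a \<Rightarrow>\<^sub>0 'b::zero) \<Rightarrow> 'a set" where "keys \<equiv> Poly_Mapping.keys"
abbreviation lookup :: "('a \<Rightarrow>\<^sub>0 'b::zero) \<Rightarrow> 'a \<Rightarrow> 'b" where "lookup \<equiv> Poly_Mapping.lookup"

definition up_set :: "('n \<Rightarrow> nat) set \<Rightarrow> bool" where
  "up_set U \<longleftrightarrow> (\<forall>v\<in>U. \<forall>w. v + w \<in> U)"

text \<open>The \<open>K\<close>-span of the monomials with exponent in \<open>U\<close>: a monomial
  ideal if \<open>U\<close> is an \<open>up_set\<close>, and a representative of a Stanley space if
  \<open>U\<close> is a cone.\<close>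

definition supported :: "('n \<Rightarrow> nat) set \<Rightarrow> ('n, 'k::field) mpoly set" where
  "supported U = {f. Poly_Mapping.keys f \<subseteq> U}"

text \<open>The exponents of the monomials in \<open>x^c K[Z]\<close>.\<close>

definition cone :: "('n \<Rightarrow> nat) \<Rightarrow> 'n set \<Rightarrow> ('n \<Rightarrow> nat) set" where
  "cone c Z = {b. c \<le> b \<and> (\<forall>j. j \<notin> Z \<longrightarrow> b j = c j)}"

text \<open>Ideals in terms of the type class operations, so that ordinary arithmetic applies;
  \<open>ideal_iff_ideal_set\<close> links them to \<open>mpoly_ring\<close>.\<close>

definition ideal_set :: "'a::comm_ring_1 set \<Rightarrow> bool" where
  "ideal_set C \<longleftrightarrow> 0 \<in> C \<and> (\<forall>x\<in>C. \<forall>y\<in>C. x + y \<in> C) \<and> (\<forall>r. \<forall>x\<in>C. r * x \<in> C)"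

definition homogeneous :: "('n \<Rightarrow> int) \<Rightarrow> ('n, 'k::field) mpoly set" where
  "homogeneous a = {p. \<forall>v\<in>Poly_Mapping.keys p. (\<lambda>j. int (v j)) = a}"

section \<open>Closure properties of ideals\<close>

lemma ideal_set_zero: "ideal_set C \<Longrightarrow> 0 \<in> C"
  and ideal_set_add: "ideal_set C \<Longrightarrow> x \<in> C \<Longrightarrow> y \<in> C \<Longrightarrow> x + y \<in> C"
  and ideal_set_mult: "ideal_set C \<Longrightarrow> x \<in> C \<Longrightarrow> r * x \<in> C"
  by (simp_all add: ideal_set_def)

lemma ideal_set_uminus: "ideal_set C \<Longrightarrow> x \<in> C \<Longrightarrow> - x \<in> C"
  using ideal_set_mult[of C x "-1"] by simp

lemma ideal_set_diff: "ideal_set C \<Longrightarrow> x \<in> C \<Longrightarrow> y \<in> C \<Longrightarrow> x - y \<in> C"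
  using ideal_set_add[of C x "-y"] ideal_set_uminus[of C y] by simp

lemma ideal_set_sum: "ideal_set C \<Longrightarrow> (\<And>i. i \<in> A \<Longrightarrow> f i \<in> C) \<Longrightarrow> sum f A \<in> C"
  by (induction A rule: infinite_finite_induct) (auto intro: ideal_set_zero ideal_set_add)

lemma ideal_set_UNIV: "ideal_set UNIV"
  by (simp add: ideal_set_def)

lemma ideal_set_singleton: "ideal_set {0}"
  by (simp add: ideal_set_def)

lemma exp_le_add_diff:
  fixes c b :: "'n \<Rightarrow> nat"
  assumes "c \<le> b" shows "b = c + (b - c)"
  using assms by (auto simp: fun_eq_iff le_fun_def)

lemma cone_eq: "cone c Z = (\<lambda>v. c + v) ` exps Z"
proof -
  have "b \<in> (\<lambda>v. c + v) ` exps Z" if "b \<in> cone c Z" for b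
    using that exp_le_add_diff[of c b] by (intro image_eqI[of _ _ "b - c"]) (auto simp: cone_def exps_def)
  then show ?thesis by (auto simp: cone_def exps_def le_fun_def)
qed

lemma supported_mono: "U \<subseteq> V \<Longrightarrow> supported U \<subseteq> supported V"
  by (auto simp: supported_def)

lemma supported_iff: "f \<in> supported U \<longleftrightarrow> (\<forall>v. lookup f v \<noteq> 0 \<longrightarrow> v \<in> U)"
  by (auto simp: supported_def subset_iff in_keys_iff)

lemma single_in_supported: "b \<in> U \<Longrightarrow> Poly_Mapping.single b k \<in> supported U"
  by (simp add: supported_def)

lemma xpow_in_supported: "(xpow b :: ('n, 'k::field) mpoly) \<in> supported U \<longleftrightarrow> b \<in> U"
  by (simp add: supported_def xpow_def)

lemma zero_in_supported: "0 \<in> supported U"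
  by (simp add: supported_def)

lemma add_in_supported: "f \<in> supported U \<Longrightarrow> g \<in> supported U \<Longrightarrow> f + g \<in> supported U"
  by (metis (no_types, lifting) add.right_neutral lookup_add supported_iff)

lemma sum_in_supported: "(\<And>i. i \<in> A \<Longrightarrow> f i \<in> supported U) \<Longrightarrow> sum f A \<in> supported U"
  by (induction A rule: infinite_finite_induct) (auto intro: zero_in_supported add_in_supported)

lemma xpow_mult_xpow: "xpow v * xpow w = xpow (v + w)"
  by (simp add: xpow_def mult_single)

lemma single_eq_mult_xpow: "Poly_Mapping.single v k = scalar k * xpow v"
  by (simp add: xpow_def scalar_def mult_single)

lemma xpow_0: "xpow 0 = 1"
  by (simp add: xpow_def)

lemma poly_eq_sum_keys:
  "f = (\<Sum>v\<in>keys f. Poly_Mapping.single v (lookup f v))"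
proof (rule poly_mapping_eqI)
  fix w
  have "lookup (\<Sum>v\<in>keys f. Poly_Mapping.single v (lookup f v)) w
      = (\<Sum>v\<in>keys f. if v = w then lookup f v else 0)"
    unfolding lookup_sum by (intro sum.cong) (auto simp: lookup_single when_def)
  also have "\<dots> = lookup f w"
    by (simp add: in_keys_iff)
  finally show "lookup f w = lookup (\<Sum>v\<in>keys f. Poly_Mapping.single v (lookup f v)) w" by simp
qed

text \<open>No cancellation can occur at an exponent that arises in at most one way as a sum of
  exponents of \<open>f\<close> and \<open>g\<close>: the convolution reduces to one
  product.\<close>

lemma lookup_mult_unique:
  fixes f g :: "('n, 'k::field) mpoly"
  assumes "\<And>a' b'. a' \<in> keys f \<Longrightarrow> b' \<in> keys g \<Longrightarrow> a' + b' = a + b \<Longrightarrow> a' = a \<and> b' = b"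
  shows "lookup (f * g) (a + b) = lookup f a * lookup g b"
proof -
  have "lookup f l * (\<Sum>q. lookup g q when a + b = l + q) = (lookup f a * lookup g b when l = a)" for l
  proof (cases "l = a")
    case True
    then show ?thesis by simp
  next
    case l: False
    show ?thesis
    proof (cases "lookup f l = 0")
      case False
      have "lookup g q = 0" if "a + b = l + q" for q
        using assms[of l q] l False that by (auto simp: in_keys_iff)
      then have "(\<lambda>q. lookup g q when a + b = l + q) = (\<lambda>q. 0)"
        by (auto simp: fun_eq_iff when_def)
      then have "(\<Sum>q. lookup g q when a + b = l + q) = 0" by (simp only: Sum_any.neutral)
      then show ?thesis using l by simp
    qed (use l in simp)
  qed
  then show ?thesis unfolding lookup_mult by simp
qed

lemma lookup_mult_xpow: "lookup (f * xpow c) (v + c) = lookup (f :: ('n, 'k::field) mpoly) v"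
  using lookup_mult_unique[of f "xpow c" v c] by (auto simp: xpow_def)

lemma keys_mult_xpow: "keys (f * xpow c) = (\<lambda>v. v + c) ` keys (f :: ('n, 'k::field) mpoly)"
proof
  show "keys (f * xpow c) \<subseteq> (\<lambda>v. v + c) ` keys f"
    using keys_mult[of f "xpow c"] by (auto simp: xpow_def)
  show "(\<lambda>v. v + c) ` keys f \<subseteq> keys (f * xpow c)"
    by (auto simp: in_keys_iff lookup_mult_xpow)
qed

lemma ideal_set_supported:
  assumes "up_set U" shows "ideal_set (supported U)"
proof -
  have "r * f \<in> supported U" if "f \<in> supported U" for r f
  proof -
    have "a + b \<in> U" if "b \<in> keys f" for a b
    proof -
      have "b \<in> U" using that \<open>f \<in> supported U\<close> by (auto simp: supported_def)
      then have "b + a \<in> U" using assms by (auto simp: up_set_def)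
      then show ?thesis by (simp add: add.commute)
    qed
    then show ?thesis using keys_mult[of r f] by (auto simp: supported_def)
  qed
  then show ?thesis
    by (auto simp: ideal_set_def intro: zero_in_supported add_in_supported)
qed

text \<open>The coordinate projection onto the span of the monomials in \<open>U\<close>. It yields
  both homogeneous parts and parts lying in a cone.\<close>

definition poly_part :: "('n \<Rightarrow> nat) set \<Rightarrow> ('n, 'k::field) mpoly \<Rightarrow> ('n, 'k) mpoly" where
  "poly_part U f = (\<Sum>v\<in>keys f \<inter> U. Poly_Mapping.single v (lookup f v))"

lemma lookup_poly_part: "lookup (poly_part U f) v = (if v \<in> U then lookup f v else 0)"
proof -
  have "lookup (poly_part U f) v = (\<Sum>w\<in>keys f \<inter> U. if w = v then lookup f w else 0)"
    unfolding poly_part_def lookup_sum by (intro sum.cong) (auto simp: lookup_single when_def)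
  also have "\<dots> = (if v \<in> U then lookup f v else 0)"
    by (auto simp: in_keys_iff)
  finally show ?thesis .
qed

lemma keys_poly_part: "keys (poly_part U f) = keys f \<inter> U"
  by (auto simp: in_keys_iff lookup_poly_part split: if_splits)

text \<open>Every term is divided by \<open>xpow c\<close>; since \<open>c \<le> v\<close> on the
  cone, the subtraction \<open>v - c\<close> does not truncate.\<close>

lemma supported_cone_factor:
  assumes "f \<in> supported (cone c Z)"
  obtains r where "r \<in> subpoly Z" "f = r * xpow c"
proof -
  define r where "r = (\<Sum>v\<in>keys f. Poly_Mapping.single (v - c) (lookup f v))"
  have k: "v - c \<in> exps Z \<and> v = (v - c) + c" if "v \<in> keys f" for v
    using that assms exp_le_add_diff[of c v]
    by (auto simp: supported_def cone_def exps_def add.commute)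
  have "r \<in> supported (exps Z)"
    unfolding r_def using k by (intro sum_in_supported single_in_supported) auto
  moreover have "f = r * xpow c"
  proof -
    have "r * xpow c = (\<Sum>v\<in>keys f. Poly_Mapping.single v (lookup f v))"
      unfolding r_def sum_distrib_right
      using k by (intro sum.cong) (auto simp: xpow_def mult_single)
    then show ?thesis using poly_eq_sum_keys[of f] by simp
  qed
  ultimately show ?thesis using that by (auto simp: supported_def subpoly_def)
qed

section \<open>Monomial ideals and monomial primes\<close>

lemma mpoly_ring_simps [simp]:
  "carrier mpoly_ring = UNIV" "\<zero>\<^bsub>mpoly_ring\<^esub> = 0" "\<one>\<^bsub>mpoly_ring\<^esub> = 1"
  "x \<otimes>\<^bsub>mpoly_ring\<^esub> y = x * y" "x \<oplus>\<^bsub>mpoly_ring\<^esub> y = x + y"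
  by (simp_all add: ring_of_type_algebra_def)

lemma ideal_iff_ideal_set:
  "ideal C (mpoly_ring :: ('n, 'k::field) mpoly ring) \<longleftrightarrow> ideal_set C"
proof
  assume "ideal C (mpoly_ring :: ('n, 'k) mpoly ring)"
  then interpret ideal C "mpoly_ring :: ('n, 'k) mpoly ring" .
  show "ideal_set C"
    using a_closed I_l_closed zero_closed additive_subgroup.zero_closed[OF is_additive_subgroup]
      additive_subgroup.a_closed[OF is_additive_subgroup]
    by (auto simp: ideal_set_def)
next
  assume C: "ideal_set C"
  interpret R: cring "mpoly_ring :: ('n, 'k) mpoly ring" by (rule cring_from_type_algebra)
  have inv: "\<ominus>\<^bsub>mpoly_ring\<^esub> x = - x" for x :: "('n, 'k) mpoly"
    by (rule R.sum_zero_eq_neg[symmetric]) auto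
  show "ideal C (mpoly_ring :: ('n, 'k) mpoly ring)"
  proof (rule idealI)
    show "subgroup C (add_monoid (mpoly_ring :: ('n, 'k) mpoly ring))"
    proof (rule R.add.subgroupI)
      show "\<ominus>\<^bsub>mpoly_ring\<^esub> x \<in> C" if "x \<in> C" for x
        using ideal_set_uminus[OF C that] by (simp only: inv)
      show "C \<noteq> {}" using ideal_set_zero[OF C] by blast
    qed (simp_all add: ideal_set_add[OF C])
    show "ring (mpoly_ring :: ('n, 'k) mpoly ring)" by (rule R.ring_axioms)
  next
    fix a x :: "('n, 'k) mpoly" assume "a \<in> C"
    then have "x * a \<in> C" by (rule ideal_set_mult[OF C])
    then show "x \<otimes>\<^bsub>mpoly_ring\<^esub> a \<in> C" "a \<otimes>\<^bsub>mpoly_ring\<^esub> x \<in> C"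
      by (simp_all add: mult.commute)
  qed
qed

text \<open>The right-hand side is an ideal containing the generators; conversely, each term of a
  polynomial supported there is a multiple of some \<open>xpow a\<close>.\<close>

lemma genideal_eq_supported:
  "Idl\<^bsub>mpoly_ring\<^esub> ((xpow :: _ \<Rightarrow> ('n, 'k::field) mpoly) ` A) = supported {b. \<exists>a\<in>A. a \<le> b}"
proof -
  let ?U = "{b. \<exists>a\<in>A. a \<le> b}"
  interpret R: cring "mpoly_ring :: ('n, 'k) mpoly ring" by (rule cring_from_type_algebra)
  have up: "up_set ?U"
    by (auto simp: up_set_def le_fun_def intro: trans_le_add1)
  have gen: "ideal_set (Idl\<^bsub>mpoly_ring\<^esub> ((xpow :: _ \<Rightarrow> ('n, 'k) mpoly) ` A))"
    unfolding ideal_iff_ideal_set[symmetric] by (rule R.genideal_ideal) auto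
  show ?thesis
  proof
    show "Idl\<^bsub>mpoly_ring\<^esub> ((xpow :: _ \<Rightarrow> ('n, 'k) mpoly) ` A) \<subseteq> supported ?U"
      by (rule R.genideal_minimal)
        (auto simp: ideal_iff_ideal_set ideal_set_supported[OF up] xpow_in_supported)
    show "supported ?U \<subseteq> Idl\<^bsub>mpoly_ring\<^esub> ((xpow :: _ \<Rightarrow> ('n, 'k) mpoly) ` A)"
    proof
      fix f :: "('n, 'k) mpoly" assume f: "f \<in> supported ?U"
      have "Poly_Mapping.single v (lookup f v) \<in> Idl\<^bsub>mpoly_ring\<^esub> (xpow ` A)" if v: "v \<in> keys f" for v
      proof -
        obtain a where a: "a \<in> A" "a \<le> v" using f v by (auto simp: supported_def)
        have "xpow a \<in> Idl\<^bsub>mpoly_ring\<^esub> ((xpow :: _ \<Rightarrow> ('n, 'k) mpoly) ` A)"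
          using R.genideal_self[of "xpow ` A"] a(1) by auto
        from ideal_set_mult[OF gen this, of "Poly_Mapping.single (v - a) (lookup f v)"]
        show ?thesis using exp_le_add_diff[OF a(2)] by (simp add: xpow_def mult_single add.commute)
      qed
      then show "f \<in> Idl\<^bsub>mpoly_ring\<^esub> (xpow ` A)"
        by (subst poly_eq_sum_keys) (rule ideal_set_sum[OF gen])
    qed
  qed
qed

text \<open>Takes the place of leading terms: no monomial order on \<open>'n \<Rightarrow> nat\<close> is available.\<close>
lemma exists_unique_sum:
  fixes K1 K2 :: "('n \<Rightarrow> nat) set"
  assumes "finite V" "finite K1" "K1 \<noteq> {}" "finite K2" "K2 \<noteq> {}"
  shows "\<exists>a\<in>K1. \<exists>b\<in>K2. \<forall>a'\<in>K1. \<forall>b'\<in>K2. (\<forall>j\<in>V. a' j + b' j = a j + b j)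
           \<longrightarrow> (\<forall>j\<in>V. a' j = a j \<and> b' j = b j)"
  using assms
proof (induction V arbitrary: K1 K2 rule: finite_induct)
  case empty
  then show ?case by auto
next
  case (insert i V)
  \<comment> \<open>A lexicographic maximum, one coordinate at a time: a competing pair with the
    same sum at \<open>i\<close> must attain both maxima, so it stays in \<open>L1\<close> and
    \<open>L2\<close>, where the induction hypothesis applies.\<close>
  define m1 m2 where "m1 = Max ((\<lambda>a. a i) ` K1)" and "m2 = Max ((\<lambda>a. a i) ` K2)"
  define L1 L2 where "L1 = {a\<in>K1. a i = m1}" and "L2 = {a\<in>K2. a i = m2}"
  have "m1 \<in> (\<lambda>a. a i) ` K1" "m2 \<in> (\<lambda>a. a i) ` K2"
    unfolding m1_def m2_def using insert by (auto intro!: Max_in simp del: Max_in)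
  then have "L1 \<noteq> {}" "L2 \<noteq> {}" by (auto simp: L1_def L2_def)
  moreover have "finite L1" "finite L2" using insert by (auto simp: L1_def L2_def)
  ultimately obtain a b where ab: "a \<in> L1" "b \<in> L2"
    and uniq: "\<And>a' b'. a' \<in> L1 \<Longrightarrow> b' \<in> L2 \<Longrightarrow> (\<forall>j\<in>V. a' j + b' j = a j + b j)
           \<Longrightarrow> (\<forall>j\<in>V. a' j = a j \<and> b' j = b j)"
    using insert.IH[of L1 L2] by blast
  have le: "a' i \<le> m1" if "a' \<in> K1" for a' using that insert.prems by (auto simp: m1_def)
  have le2: "a' i \<le> m2" if "a' \<in> K2" for a' using that insert.prems by (auto simp: m2_def)
  show ?case
  proof (intro bexI ballI impI)
    fix a' b' j assume *: "a' \<in> K1" "b' \<in> K2" "\<forall>j\<in>insert i V. a' j + b' j = a j + b j" "j \<in> insert i V"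
    have "a' i = m1" "b' i = m2"
      using *(3) le[OF *(1)] le2[OF *(2)] ab by (auto simp: L1_def L2_def)
    then have "a' \<in> L1" "b' \<in> L2" using * by (auto simp: L1_def L2_def)
    then show "a' j = a j \<and> b' j = b j"
      using uniq[of a' b'] * ab by (auto simp: L1_def L2_def)
  qed (use ab in \<open>auto simp: L1_def L2_def\<close>)
qed

section \<open>Monomial primes\<close>

lemma up_set_non_exps: "up_set (- exps Z)"
  by (auto simp: up_set_def exps_def)

text \<open>This is the ideal of the variables outside \<open>Z\<close>. If neither factor lies in
  it, both have terms in \<open>K[Z]\<close>, and a uniquely attained sum of exponents of such terms
  survives in the product.\<close>

lemma primeideal_non_exps:
  "primeideal (supported (- exps Z)) (mpoly_ring :: ('n::finite, 'k::field) mpoly ring)"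
proof (rule primeidealI)
  show "ideal (supported (- exps Z)) (mpoly_ring :: ('n, 'k) mpoly ring)"
    by (simp add: ideal_iff_ideal_set ideal_set_supported up_set_non_exps)
  show "cring (mpoly_ring :: ('n, 'k) mpoly ring)" by (rule cring_from_type_algebra)
  have "(1 :: ('n, 'k) mpoly) \<notin> supported (- exps Z)" by (simp add: supported_def exps_def)
  then show "carrier (mpoly_ring :: ('n, 'k) mpoly ring) \<noteq> supported (- exps Z)" by auto
  fix f g :: "('n, 'k) mpoly"
  assume "f \<otimes>\<^bsub>mpoly_ring\<^esub> g \<in> supported (- exps Z)"
  then have fg: "f * g \<in> supported (- exps Z)" by simp
  show "f \<in> supported (- exps Z) \<or> g \<in> supported (- exps Z)"
  proof (rule ccontr)
    assume "\<not> ?thesis"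
    then have ne: "keys f \<inter> exps Z \<noteq> {}" "keys g \<inter> exps Z \<noteq> {}" by (auto simp: supported_def)
    obtain a b where ab: "a \<in> keys f \<inter> exps Z" "b \<in> keys g \<inter> exps Z"
      and uniq: "\<And>a' b'. a' \<in> keys f \<inter> exps Z \<Longrightarrow> b' \<in> keys g \<inter> exps Z \<Longrightarrow>
        (\<forall>j. a' j + b' j = a j + b j) \<Longrightarrow> (\<forall>j. a' j = a j \<and> b' j = b j)"
    proof -
      have "\<exists>a\<in>keys f \<inter> exps Z. \<exists>b\<in>keys g \<inter> exps Z. \<forall>a'\<in>keys f \<inter> exps Z. \<forall>b'\<in>keys g \<inter> exps Z.
        (\<forall>j\<in>UNIV. a' j + b' j = a j + b j) \<longrightarrow> (\<forall>j\<in>UNIV. a' j = a j \<and> b' j = b j)"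
        by (intro exists_unique_sum) (use ne in auto)
      then show ?thesis using that by blast
    qed
    \<comment> \<open>Exponents are nonnegative, so a sum vanishing outside \<open>Z\<close> has
      both summands vanishing there. Uniqueness among the terms in \<open>K[Z]\<close> thus extends
      to all terms.\<close>
    have "a' = a \<and> b' = b" if "a' \<in> keys f" "b' \<in> keys g" "a' + b' = a + b" for a' b'
    proof -
      have eq: "\<forall>j. a' j + b' j = a j + b j" using that(3) by (metis plus_fun_apply)
      then have "a' \<in> exps Z \<and> b' \<in> exps Z"
      proof -
        have "a' j = 0 \<and> b' j = 0" if "j \<notin> Z" for j
          using eq[rule_format, of j] that ab by (auto simp: exps_def)
        then show ?thesis by (auto simp: exps_def)
      qed
      then show ?thesis using uniq[of a' b'] that eq by (auto simp: fun_eq_iff)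
    qed
    then have "lookup (f * g) (a + b) = lookup f a * lookup g b" by (rule lookup_mult_unique)
    also have "\<dots> \<noteq> 0" using ab by (auto simp: in_keys_iff)
    finally have "a + b \<in> - exps Z" using fg by (simp add: supported_iff)
    then show False using ab by (auto simp: exps_def)
  qed
qed

text \<open>The exponent set is upward closed, so all its monomials can serve as generators.\<close>

lemma monomial_ideal_non_exps:
  "monomial_ideal (supported (- exps Z) :: ('n, 'k::field) mpoly set)"
proof -
  have "{b. \<exists>a\<in>- exps Z. a \<le> b} \<subseteq> - exps Z"
  proof
    fix b :: "'n \<Rightarrow> nat" assume "b \<in> {b. \<exists>a\<in>- exps Z. a \<le> b}"
    then obtain a where a: "a \<in> - exps Z" "a \<le> b" by (elim CollectE bexE)
    then obtain j where j: "j \<notin> Z" "a j \<noteq> 0" unfolding exps_def by auto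
    from a(2) have "a j \<le> b j" by (rule le_funD)
    then show "b \<in> - exps Z" using j by (auto simp: exps_def)
  qed
  moreover have "- exps Z \<subseteq> {b. \<exists>a\<in>- exps Z. a \<le> b}"
    by (intro subsetI CollectI) (erule rev_bexI, rule order_refl)
  ultimately have "- exps Z = {b. \<exists>a\<in>- exps Z. a \<le> b}" by (rule subset_antisym[rotated])
  then have "(supported (- exps Z) :: ('n, 'k) mpoly set) = Idl\<^bsub>mpoly_ring\<^esub> (xpow ` (- exps Z))"
    unfolding genideal_eq_supported by (rule arg_cong)
  then show ?thesis unfolding monomial_ideal_def by (rule exI)
qed

lemma xvar_in_non_exps_iff: "(xvar j :: ('n, 'k::field) mpoly) \<in> supported (- exps Z) \<longleftrightarrow> j \<notin> Z"
  unfolding xvar_def xpow_in_supported by (auto simp: exps_def)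

text \<open>A prime containing a monomial contains one of its variables. The induction on total
  degree strips one variable at a time and ends at 1, which is not in \<open>P\<close>.\<close>

lemma xpow_in_prime_iff:
  fixes P :: "('n::finite, 'k::field) mpoly set"
  assumes "primeideal P mpoly_ring"
  shows "xpow v \<in> P \<longleftrightarrow> v \<notin> exps {j. xvar j \<notin> P}"
proof -
  interpret primeideal P "mpoly_ring :: ('n, 'k) mpoly ring" by fact
  have P: "ideal_set P" using is_ideal by (simp add: ideal_iff_ideal_set)
  have one: "1 \<notin> P"
    using I_notcarr ideal_set_mult[OF P, of 1] by auto
  have prime: "x * y \<in> P \<Longrightarrow> x \<in> P \<or> y \<in> P" for x y
    using I_prime[of x y] by simp
  have split: "xpow v = xpow (v(j := v j - 1)) * (xvar j :: ('n, 'k) mpoly)" if "v j \<noteq> 0" for v j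
    unfolding xvar_def xpow_mult_xpow
    by (rule arg_cong[of _ _ xpow]) (use that in \<open>auto simp: fun_eq_iff\<close>)
  show ?thesis
  proof
    show "v \<notin> exps {j. xvar j \<notin> P}" if "xpow v \<in> P"
      using that
    proof (induction "sum v UNIV" arbitrary: v rule: less_induct)
      case less
      show ?case
      proof (cases "v = 0")
        case True
        then show ?thesis using less one by (simp add: xpow_0)
      next
        case False
        then obtain j where j: "v j \<noteq> 0" by (auto simp: fun_eq_iff)
        show ?thesis
        proof (cases "xvar j \<in> P")
          case True
          then show ?thesis using j by (auto simp: exps_def)
        next
          case nj: False
          let ?w = "v(j := v j - 1)"
          have "xpow ?w * xvar j \<in> P"
            using less.prems by (simp only: split[of v j, OF j, symmetric])
          then have "xpow ?w \<in> P" using prime nj by blast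
          moreover have "sum ?w UNIV < sum v UNIV"
            using j by (intro sum_strict_mono_ex1) auto
          ultimately have "?w \<notin> exps {j. xvar j \<notin> P}" using less.hyps by blast
          then show ?thesis by (auto simp: exps_def split: if_splits)
        qed
      qed
    qed
    show "xpow v \<in> P" if "v \<notin> exps {j. xvar j \<notin> P}"
      using that split[of v] ideal_set_mult[OF P] by (auto simp: exps_def)
  qed
qed

section \<open>Presentations of graded modules\<close>

text \<open>\<open>M\<close> is \<open>C / K\<close> via \<open>\<pi>\<close>, with degree \<open>a\<close> component the image of \<open>H a\<close>. All modules that
  occur, including the quotients of quotients in a filtration, are of this form.\<close>
locale presentation =
  fixes M :: "(('n, 'k::field) mpoly, 'b, 'n) gmodule"
    and \<pi> :: "('n, 'k) mpoly \<Rightarrow> 'b"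
    and C K :: "('n, 'k) mpoly set"
    and H :: "('n \<Rightarrow> int) \<Rightarrow> ('n, 'k) mpoly set"
  assumes C: "ideal_set C" and K: "ideal_set K" and K_subset: "K \<subseteq> C"
    and carrier_eq: "carrier M = \<pi> ` C"
    and zero_eq: "\<zero>\<^bsub>M\<^esub> = \<pi> 0"
    and add_eq: "x \<in> C \<Longrightarrow> y \<in> C \<Longrightarrow> \<pi> x \<oplus>\<^bsub>M\<^esub> \<pi> y = \<pi> (x + y)"
    and smult_eq: "x \<in> C \<Longrightarrow> r \<odot>\<^bsub>M\<^esub> \<pi> x = \<pi> (r * x)"
    and eq_iff: "x \<in> C \<Longrightarrow> y \<in> C \<Longrightarrow> \<pi> x = \<pi> y \<longleftrightarrow> x - y \<in> K"
    and hcomp_eq: "hcomp M a = \<pi> ` (C \<inter> H a)"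
begin

lemma abelian_group: "abelian_group M"
proof (rule abelian_groupI)
  fix x assume "x \<in> carrier M"
  then obtain x' where x': "x' \<in> C" "x = \<pi> x'" by (auto simp: carrier_eq)
  then have "\<pi> (- x') \<oplus>\<^bsub>M\<^esub> x = \<zero>\<^bsub>M\<^esub>" "\<pi> (- x') \<in> carrier M"
    using ideal_set_uminus[OF C x'(1)] by (auto simp: add_eq zero_eq carrier_eq)
  then show "\<exists>y\<in>carrier M. y \<oplus>\<^bsub>M\<^esub> x = \<zero>\<^bsub>M\<^esub>" by blast
qed (use ideal_set_zero[OF C] in
    \<open>auto simp: carrier_eq zero_eq add_eq ideal_set_add[OF C] algebra_simps\<close>)

lemma finsum_eq:
  assumes "\<And>i. i \<in> A \<Longrightarrow> f i \<in> C"
  shows "(\<Oplus>\<^bsub>M\<^esub>i\<in>A. \<pi> (f i)) = \<pi> (sum f A)"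
proof -
  interpret abelian_group M by (rule abelian_group)
  show ?thesis
    using assms
  proof (induction A rule: infinite_finite_induct)
    case (insert i A)
    then show ?case
      by (subst finsum_insert)
        (auto simp: carrier_eq add_eq ideal_set_sum[OF C])
  qed (auto simp: finsum_infinite zero_eq)
qed

lemma submodule_image:
  assumes "ideal_set N" "N \<subseteq> C"
  shows "submodule (\<pi> ` N) mpoly_ring M"
proof -
  interpret abelian_group M by (rule abelian_group)
  have inv: "\<ominus>\<^bsub>M\<^esub> \<pi> x = \<pi> (- x)" if "x \<in> N" for x
    using that assms ideal_set_uminus[OF C, of x]
    by (intro minus_equality) (auto simp: add_eq zero_eq carrier_eq)
  show ?thesis
  proof (intro submodule.intro submodule_axioms.intro)
    show "subgroup (\<pi> ` N) (add_monoid M)"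
    proof (rule add.subgroupI)
      show "\<ominus>\<^bsub>M\<^esub> y \<in> \<pi> ` N" if "y \<in> \<pi> ` N" for y
        using that inv ideal_set_uminus[OF assms(1)] by auto
      show "\<pi> ` N \<noteq> {}" using ideal_set_zero[OF assms(1)] by blast
      show "\<pi> ` N \<subseteq> carrier M" using assms(2) by (auto simp: carrier_eq)
      show "x \<oplus>\<^bsub>M\<^esub> y \<in> \<pi> ` N" if "x \<in> \<pi> ` N" "y \<in> \<pi> ` N" for x y
        using that assms by (auto simp: add_eq subset_iff ideal_set_add)
    qed
    show "a \<odot>\<^bsub>M\<^esub> x \<in> \<pi> ` N" if "x \<in> \<pi> ` N" for a x
      using that assms by (auto simp: smult_eq subset_iff ideal_set_mult)
  qed
qed

text \<open>The correspondence between submodules of \<open>C / K\<close> and ideals between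
  \<open>K\<close> and \<open>C\<close>, which lets submodules be handled as sets of
  polynomials.\<close>

lemma submodule_preimage:
  assumes "submodule N mpoly_ring M"
  shows "ideal_set {x\<in>C. \<pi> x \<in> N}" "K \<subseteq> {x\<in>C. \<pi> x \<in> N}" "\<pi> ` {x\<in>C. \<pi> x \<in> N} = N"
proof -
  interpret submodule N mpoly_ring M by fact
  have N: "N \<subseteq> \<pi> ` C" using subset by (simp add: carrier_eq)
  have z: "\<pi> 0 \<in> N" using one_closed by (simp add: zero_eq)
  show "ideal_set {x\<in>C. \<pi> x \<in> N}"
    unfolding ideal_set_def
    using z ideal_set_zero[OF C] ideal_set_add[OF C] ideal_set_mult[OF C] m_closed smult_closed
    by (auto simp: add_eq[symmetric] smult_eq[symmetric])
  show "K \<subseteq> {x\<in>C. \<pi> x \<in> N}"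
  proof
    fix x assume x: "x \<in> K"
    then have "\<pi> x = \<pi> 0" using eq_iff[of x 0] K_subset ideal_set_zero[OF C] by auto
    then show "x \<in> {x\<in>C. \<pi> x \<in> N}" using x z K_subset by auto
  qed
  show "\<pi> ` {x\<in>C. \<pi> x \<in> N} = N" using N by auto
qed

text \<open>Cosets of cosets are labelled by polynomials again: a quotient of submodules of
  \<open>C / K\<close> is presented as \<open>N' / N\<close>, with the same grading
  \<open>H\<close>.\<close>

lemma subquotient:
  assumes N: "ideal_set N" and N': "ideal_set N'" and sub: "K \<subseteq> N" "N \<subseteq> N'" "N' \<subseteq> C"
  shows "presentation (gquot (gsub M (\<pi> ` N')) (\<pi> ` N)) (\<lambda>x. \<pi> ` N +>\<^bsub>M\<^esub> \<pi> x) N' N H"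
proof -
  let ?q = "\<lambda>x. \<pi> ` N +>\<^bsub>M\<^esub> \<pi> x"
  have in_C: "x \<in> C" if "x \<in> N'" for x using that sub by auto
  have in_C': "x \<in> C" if "x \<in> N" for x using that sub by auto
  have coset: "?q x = (\<lambda>n. \<pi> (n + x)) ` N" if "x \<in> N'" for x
    using that in_C in_C' by (auto simp: a_r_coset_def' add_eq intro!: image_eqI)
  have coset_gsub: "\<pi> ` N +>\<^bsub>gsub M (\<pi> ` N')\<^esub> y = \<pi> ` N +>\<^bsub>M\<^esub> y" for y
    by (simp add: a_r_coset_def' gsub_def)
  have in_coset: "\<pi> y \<in> ?q x \<longleftrightarrow> y - x \<in> N" if "x \<in> N'" "y \<in> N'" for x y
  proof
    assume "\<pi> y \<in> ?q x"
    then have "\<pi> y \<in> (\<lambda>n. \<pi> (n + x)) ` N" by (simp only: coset[OF that(1)])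
    then obtain n where n: "n \<in> N" "\<pi> y = \<pi> (n + x)" by auto
    then have "y - (n + x) \<in> N"
      using eq_iff[of y "n + x"] in_C[OF that(2)] in_C[OF that(1)] in_C'[OF n(1)]
        ideal_set_add[OF C] sub(1) by blast
    from ideal_set_add[OF N this n(1)] show "y - x \<in> N" by (simp add: algebra_simps)
  next
    assume "y - x \<in> N"
    then show "\<pi> y \<in> ?q x" unfolding coset[OF that(1)] by (intro image_eqI[of _ _ "y - x"]) auto
  qed
  have q_eq: "?q x = ?q y" if "x \<in> N'" "y \<in> N'" "x - y \<in> N" for x y
  proof -
    have "?q u \<subseteq> ?q v" if "u \<in> N'" "v \<in> N'" "u - v \<in> N" for u v
    proof
      fix z assume "z \<in> ?q u"
      then have "z \<in> (\<lambda>n. \<pi> (n + u)) ` N" by (simp only: coset[OF that(1)])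
      then obtain n where "n \<in> N" "z = \<pi> (n + u)" by auto
      then show "z \<in> ?q v" unfolding coset[OF that(2)]
        by (intro image_eqI[of _ _ "n + (u - v)"]) (use ideal_set_add[OF N] that in auto)
    qed
    moreover have "y - x \<in> N" using ideal_set_uminus[OF N that(3)] by simp
    ultimately show ?thesis using that by blast
  qed
  show ?thesis
  proof
    show "carrier (gquot (gsub M (\<pi> ` N')) (\<pi> ` N)) = ?q ` N'"
      by (auto simp: gquot_def A_RCOSETS_def' coset_gsub) (auto simp: gsub_def)
    show "\<zero>\<^bsub>gquot (gsub M (\<pi> ` N')) (\<pi> ` N)\<^esub> = ?q 0"
      using coset[OF ideal_set_zero[OF N']] by (simp add: gquot_def)
    show "(?q x = ?q y) = (x - y \<in> N)" if "x \<in> N'" "y \<in> N'" for x y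
      using q_eq[OF that] in_coset[OF that(2,1)] in_coset[OF that(1,1)] ideal_set_zero[OF N] by auto
    show "?q x \<oplus>\<^bsub>gquot (gsub M (\<pi> ` N')) (\<pi> ` N)\<^esub> ?q y = ?q (x + y)" if "x \<in> N'" "y \<in> N'" for x y
    proof -
      have "?q x \<oplus>\<^bsub>gquot (gsub M (\<pi> ` N')) (\<pi> ` N)\<^esub> ?q y
          = (\<Union>a\<in>?q x. \<Union>b\<in>?q y. {a \<oplus>\<^bsub>M\<^esub> b})"
        by (simp add: gquot_def set_add_def' gsub_def)
      also have "\<dots> = (\<Union>a\<in>N. \<Union>b\<in>N. {\<pi> ((a + b) + (x + y))})"
        using that in_C in_C' ideal_set_add[OF C]
        by (simp add: coset add_eq algebra_simps)
      also have "\<dots> = ?q (x + y)"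
        unfolding coset[OF ideal_set_add[OF N' that]]
        using ideal_set_add[OF N] ideal_set_zero[OF N] by (auto 0 3 intro: bexI[of _ 0])
      finally show ?thesis .
    qed
    show "r \<odot>\<^bsub>gquot (gsub M (\<pi> ` N')) (\<pi> ` N)\<^esub> ?q x = ?q (r * x)" if "x \<in> N'" for x r
    proof -
      have "r \<odot>\<^bsub>gquot (gsub M (\<pi> ` N')) (\<pi> ` N)\<^esub> ?q x
          = (\<Union>a\<in>?q x. \<pi> ` N +>\<^bsub>M\<^esub> (r \<odot>\<^bsub>M\<^esub> a))"
        by (simp add: gquot_def coset_gsub) (simp add: gsub_def)
      also have "\<dots> = (\<Union>a\<in>N. ?q (r * (a + x)))"
        using that in_C in_C' ideal_set_add[OF C] by (simp add: coset smult_eq)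
      \<comment> \<open>Changing the representative by \<open>a\<close> changes the product by
        \<open>r * a\<close>, which is in \<open>N\<close>.\<close>
      also have "\<dots> = (\<Union>a\<in>N. ?q (r * x))"
      proof (intro SUP_cong refl q_eq)
        fix a assume a: "a \<in> N"
        then show "r * (a + x) \<in> N'" "r * x \<in> N'"
          using that sub by (auto intro!: ideal_set_mult[OF N'] ideal_set_add[OF N'])
        show "r * (a + x) - r * x \<in> N" using ideal_set_mult[OF N a, of r] by (simp add: algebra_simps)
      qed
      also have "\<dots> = ?q (r * x)" using ideal_set_zero[OF N] by auto
      finally show ?thesis .
    qed
    show "hcomp (gquot (gsub M (\<pi> ` N')) (\<pi> ` N)) a = ?q ` (N' \<inter> H a)" for a
    proof -
      have "hcomp (gsub M (\<pi> ` N')) a = \<pi> ` (N' \<inter> H a)"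
      proof -
        \<comment> \<open>The homogeneous representative \<open>x\<close> is only known to be in
          \<open>C\<close>. It differs from \<open>y\<close> in \<open>N'\<close> by an element of
          \<open>K\<close>, so it lies in \<open>N'\<close> too.\<close>
        have "\<pi> x \<in> \<pi> ` (N' \<inter> H a)" if x: "x \<in> C" "x \<in> H a" "y \<in> N'" "\<pi> x = \<pi> y" for x y
        proof -
          have "x - y \<in> N'" using eq_iff[of x y] x in_C sub by blast
          from ideal_set_add[OF N' this x(3)] have "x \<in> N'" by simp
          then show ?thesis using x by blast
        qed
        then show ?thesis using in_C unfolding gsub_def hcomp_eq by fastforce
      qed
      then show ?thesis unfolding gquot_def by (simp add: coset_gsub image_image)
    qed
  qed (use assms in auto)
qed

end

text \<open>A linear map \<open>t\<close> from \<open>C2\<close> to \<open>C1\<close> that is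
  bijective on the quotients is inverted to give the isomorphism from \<open>M1\<close> to
  \<open>M2\<close>. Surjectivity is needed in each degree, as \<open>giso\<close> maps components
  onto components.\<close>

lemma giso_presentation:
  assumes "presentation M1 \<pi>1 C1 K1 H1" "presentation M2 \<pi>2 C2 K2 H2"
    and closed: "\<And>y. y \<in> C2 \<Longrightarrow> t y \<in> C1"
    and add: "\<And>x y. t (x + y) = t x + t y"
    and mult: "\<And>r x. t (r * x) = r * t x"
    and ker: "\<And>y. y \<in> C2 \<Longrightarrow> t y \<in> K1 \<longleftrightarrow> y \<in> K2"
    and surj: "\<And>z. z \<in> C1 \<Longrightarrow> \<exists>y\<in>C2. z - t y \<in> K1"
    and hom: "\<And>a y. y \<in> C2 \<Longrightarrow> y \<in> H2 a \<Longrightarrow> t y \<in> H1 a"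
    and hom_surj: "\<And>a z. z \<in> C1 \<Longrightarrow> z \<in> H1 a \<Longrightarrow> \<exists>y\<in>C2 \<inter> H2 a. z - t y \<in> K1"
  shows "giso M1 M2"
proof -
  interpret M1: presentation M1 \<pi>1 C1 K1 H1 by fact
  interpret M2: presentation M2 \<pi>2 C2 K2 H2 by fact
  have diff: "t (x - y) = t x - t y" for x y
    using add[of "x - y" y] by (simp add: algebra_simps)
  have eq: "\<pi>1 (t y) = \<pi>1 (t y') \<longleftrightarrow> \<pi>2 y = \<pi>2 y'" if "y \<in> C2" "y' \<in> C2" for y y'
    using that ker[of "y - y'"] ideal_set_diff[OF M2.C] closed
    by (simp add: M1.eq_iff M2.eq_iff diff)
  \<comment> \<open>The inverse of the induced map, by choice of a representative; \<open>eq\<close>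
    makes the value independent of that choice.\<close>
  define h where "h x = \<pi>2 (SOME y. y \<in> C2 \<and> \<pi>1 (t y) = x)" for x
  have h: "h (\<pi>1 (t y)) = \<pi>2 y" if y: "y \<in> C2" for y
  proof -
    have "\<exists>y'. y' \<in> C2 \<and> \<pi>1 (t y') = \<pi>1 (t y)" using y by blast
    from someI_ex[OF this] show ?thesis using y eq unfolding h_def by blast
  qed
  have im: "\<exists>y\<in>C2. x = \<pi>1 (t y)" if "x \<in> carrier M1" for x
    using that surj closed by (fastforce simp: M1.carrier_eq M1.eq_iff)
  have im_hom: "hcomp M1 a = (\<lambda>y. \<pi>1 (t y)) ` (C2 \<inter> H2 a)" for a
  proof
    show "hcomp M1 a \<subseteq> (\<lambda>y. \<pi>1 (t y)) ` (C2 \<inter> H2 a)"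
    proof
      fix x assume "x \<in> hcomp M1 a"
      then obtain z where z: "z \<in> C1" "z \<in> H1 a" "x = \<pi>1 z" by (auto simp: M1.hcomp_eq)
      then obtain y where "y \<in> C2 \<inter> H2 a" "z - t y \<in> K1" using hom_surj by blast
      then show "x \<in> (\<lambda>y. \<pi>1 (t y)) ` (C2 \<inter> H2 a)"
        using M1.eq_iff[of z "t y"] z closed by auto
    qed
    show "(\<lambda>y. \<pi>1 (t y)) ` (C2 \<inter> H2 a) \<subseteq> hcomp M1 a"
      using hom closed by (auto simp: M1.hcomp_eq)
  qed
  show ?thesis
    unfolding giso_def
  proof (intro exI[of _ h] conjI ballI allI)
    show "bij_betw h (carrier M1) (carrier M2)"
    proof (rule bij_betwI')
      fix x y assume "x \<in> carrier M1" "y \<in> carrier M1"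
      then show "(h x = h y) = (x = y)" using im h eq by metis
    next
      fix x assume "x \<in> carrier M1"
      then show "h x \<in> carrier M2" using im h by (fastforce simp: M2.carrier_eq)
    next
      fix y assume "y \<in> carrier M2"
      then obtain y' where "y' \<in> C2" "y = \<pi>2 y'" by (auto simp: M2.carrier_eq)
      then show "\<exists>x\<in>carrier M1. y = h x"
        using h closed by (intro bexI[of _ "\<pi>1 (t y')"]) (auto simp: M1.carrier_eq)
    qed
    fix x assume "x \<in> carrier M1"
    then obtain x' where x: "x' \<in> C2" "x = \<pi>1 (t x')" using im by blast
    show "h (r \<odot>\<^bsub>M1\<^esub> x) = r \<odot>\<^bsub>M2\<^esub> h x" for r
      using x closed h ideal_set_mult[OF M2.C]
      by (simp add: M1.smult_eq M2.smult_eq flip: mult)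
    fix y assume "y \<in> carrier M1"
    then obtain y' where y: "y' \<in> C2" "y = \<pi>1 (t y')" using im by blast
    show "h (x \<oplus>\<^bsub>M1\<^esub> y) = h x \<oplus>\<^bsub>M2\<^esub> h y"
      using x y closed h ideal_set_add[OF M2.C]
      by (simp add: M1.add_eq M2.add_eq flip: add)
  next
    show "h ` hcomp M1 b = hcomp M2 b" for b
      unfolding im_hom M2.hcomp_eq image_image using h by (intro image_cong) auto
  qed
qed

section \<open>Presentations of the ring, its quotients and their shifts\<close>

lemma presentation_poly: "presentation poly_gmodule (\<lambda>x. x) UNIV {0} homogeneous"
  by standard (auto simp: ideal_set_UNIV ideal_set_singleton poly_gmodule_def homogeneous_def)

lemma gsub_poly_UNIV: "gsub poly_gmodule UNIV = poly_gmodule"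
  by (simp add: gsub_def poly_gmodule_def)

lemma presentation_ideal_quot:
  assumes "ideal_set I" "ideal_set J" "J \<subseteq> I"
  shows "presentation (ideal_quot I J) (\<lambda>x. J +>\<^bsub>poly_gmodule\<^esub> x) I J homogeneous"
  using presentation.subquotient[OF presentation_poly, of J I] assms ideal_set_zero[of J]
  by (simp add: ideal_quot_def)

lemma presentation_poly_quot:
  assumes "ideal_set P"
  shows "presentation (gquot poly_gmodule P) (\<lambda>x. P +>\<^bsub>poly_gmodule\<^esub> x) UNIV P homogeneous"
  using presentation_ideal_quot[of UNIV P] assms by (simp add: ideal_quot_def gsub_poly_UNIV ideal_set_UNIV)

lemma presentation_gshift:
  assumes "presentation M \<pi> C K H"
  shows "presentation (gshift M a) \<pi> C K (\<lambda>b. H (a + b))"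
  using assms unfolding presentation_def gshift_def by simp

section \<open>Filtrations by cones\<close>

text \<open>For \<open>E\<close> the exponents of \<open>I - J\<close>, these are the exponent sets
  of monomial submodules of \<open>I/J\<close>.\<close>

definition closed_in :: "('n \<Rightarrow> nat) set \<Rightarrow> ('n \<Rightarrow> nat) set \<Rightarrow> bool" where
  "closed_in E U \<longleftrightarrow> U \<subseteq> E \<and> (\<forall>b\<in>U. \<forall>v. b + v \<in> E \<longrightarrow> b + v \<in> U)"

text \<open>The combinatorial counterpart of a prime filtration. The list grows at its end, so its
  prefixes give the members of the chain; the last argument is the union of the cones so
  far.\<close>

inductive cone_filtration ::
  "('n \<Rightarrow> nat) set \<Rightarrow> (('n \<Rightarrow> nat) \<times> 'n set) list \<Rightarrow> ('n \<Rightarrow> nat) set \<Rightarrow> bool"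
  for E where
  Nil: "cone_filtration E [] {}"
| snoc: "cone_filtration E L U \<Longrightarrow> cone c Z \<inter> U = {} \<Longrightarrow> closed_in E (U \<union> cone c Z)
    \<Longrightarrow> cone_filtration E (L @ [(c, Z)]) (U \<union> cone c Z)"

definition cones :: "(('n \<Rightarrow> nat) \<times> 'n set) list \<Rightarrow> ('n \<Rightarrow> nat) set" where
  "cones L = (\<Union>(c, Z)\<in>set L. cone c Z)"

lemma self_in_cone: "c \<in> cone c Z"
  by (simp add: cone_def)

lemma cone_filtration_closed: "cone_filtration E L U \<Longrightarrow> closed_in E U"
  by (induction rule: cone_filtration.induct) (simp_all add: closed_in_def)

lemma cone_filtration_cones: "cone_filtration E L U \<Longrightarrow> U = cones L"
  by (induction rule: cone_filtration.induct) (auto simp: cones_def)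

text \<open>Each new cone misses the union of the earlier ones; as it contains its base point, it
  cannot repeat an earlier pair.\<close>

lemma cone_filtration_disjoint:
  assumes "cone_filtration E L U"
  shows "distinct L" "\<And>p q. p \<in> set L \<Longrightarrow> q \<in> set L \<Longrightarrow> p \<noteq> q \<Longrightarrow>
    cone (fst p) (snd p) \<inter> cone (fst q) (snd q) = {}"
proof -
  have "distinct L \<and> (\<forall>p\<in>set L. \<forall>q\<in>set L. p \<noteq> q \<longrightarrow>
    cone (fst p) (snd p) \<inter> cone (fst q) (snd q) = {})"
    using assms
  proof (induction rule: cone_filtration.induct)
    case (snoc L U c Z)
    have sub: "cone (fst p) (snd p) \<subseteq> U" if "p \<in> set L" for p
      using that cone_filtration_cones[OF snoc.hyps(1)] by (auto simp: cones_def)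
    have "(c, Z) \<notin> set L"
      using sub[of "(c, Z)"] snoc.hyps(2) self_in_cone[of c Z] by auto
    moreover have "cone (fst p) (snd p) \<inter> cone c Z = {}" if "p \<in> set L" for p
      using sub[OF that] snoc.hyps(2) by auto
    ultimately show ?case using snoc.IH by (auto simp: Int_commute)
  qed simp
  then show "distinct L" "\<And>p q. p \<in> set L \<Longrightarrow> q \<in> set L \<Longrightarrow> p \<noteq> q \<Longrightarrow>
    cone (fst p) (snd p) \<inter> cone (fst q) (snd q) = {}" by auto
qed

lemma cone_filtration_take:
  "cone_filtration E L U \<Longrightarrow> k \<le> length L \<Longrightarrow> cone_filtration E (take k L) (cones (take k L))"
proof (induction rule: cone_filtration.induct)
  case (snoc L U c Z)
  show ?case
  proof (cases "k \<le> length L")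
    case True
    then show ?thesis using snoc.IH by simp
  next
    case False
    then have "take k (L @ [(c, Z)]) = L @ [(c, Z)]" by simp
    then show ?thesis
      using cone_filtration.snoc[OF snoc.hyps] cone_filtration_cones by metis
  qed
qed (simp add: cones_def cone_filtration.Nil)

lemma cone_filtration_nth:
  assumes "cone_filtration E L U" "i < length L" "L ! i = (c, Z)"
  shows "closed_in E (cones (take i L))" "closed_in E (cones (take i L) \<union> cone c Z)"
    "cone c Z \<inter> cones (take i L) = {}" "cones (take (Suc i) L) = cones (take i L) \<union> cone c Z"
proof -
  have L: "take (Suc i) L = take i L @ [(c, Z)]"
    using assms by (simp add: take_Suc_conv_app_nth)
  then show cones: "cones (take (Suc i) L) = cones (take i L) \<union> cone c Z"
    by (auto simp: cones_def)
  show "closed_in E (cones (take i L))"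
    by (rule cone_filtration_closed[OF cone_filtration_take[OF assms(1)]]) (use assms(2) in simp)
  have *: "cone_filtration E (take i L @ [(c, Z)]) (cones (take (Suc i) L))"
    unfolding L[symmetric] by (rule cone_filtration_take) (use assms in auto)
  show "closed_in E (cones (take i L) \<union> cone c Z)"
    using cone_filtration_closed[OF *] unfolding cones .
  from * show "cone c Z \<inter> cones (take i L) = {}"
  proof cases
    case (snoc L' U' c' Z')
    then have "cone_filtration E (take i L) U'" by simp
    then have "U' = cones (take i L)" by (rule cone_filtration_cones)
    with snoc show ?thesis by simp
  qed simp
qed

definition saturate ::
  "('n \<Rightarrow> nat) \<Rightarrow> (('n \<Rightarrow> nat) \<times> 'n set) \<Rightarrow> (('n \<Rightarrow> nat) \<times> 'n set)" where
  "saturate g = (\<lambda>(c, Z). (c, Z \<union> {j. c j = g j}))"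

text \<open>Coordinatewise: where \<open>c j = g j\<close>, the condition
  \<open>min (b j) (g j) = c j\<close> only says \<open>c j \<le> b j\<close>, so \<open>j\<close>
  becomes a free direction; where \<open>c j < g j\<close>, it says
  \<open>b j = c j\<close>.\<close>

lemma inf_in_cone_iff:
  fixes b c g :: "'n \<Rightarrow> nat"
  assumes "c \<le> g"
  shows "inf b g \<in> cone c Z \<longleftrightarrow> b \<in> cone c (Z \<union> {j. c j = g j})"
proof -
  have "(c j \<le> min (b j) (g j) \<and> (j \<notin> Z \<longrightarrow> min (b j) (g j) = c j))
     \<longleftrightarrow> (c j \<le> b j \<and> (j \<notin> Z \<and> c j \<noteq> g j \<longrightarrow> b j = c j))" for j
    using le_funD[OF assms, of j] by (auto simp: min_def)
  then have "(\<forall>j. c j \<le> min (b j) (g j) \<and> (j \<notin> Z \<longrightarrow> min (b j) (g j) = c j))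
     \<longleftrightarrow> (\<forall>j. c j \<le> b j \<and> (j \<notin> Z \<and> c j \<noteq> g j \<longrightarrow> b j = c j))" by (simp only:)
  then show ?thesis
    by (simp only: cone_def mem_Collect_eq le_fun_def inf_fun_def inf_nat_def all_conj_distrib
        Un_iff de_Morgan_disj)
qed

text \<open>Preimages under the monotone map \<open>b \<mapsto> inf b g\<close> keep disjointness
  and closedness. A cone whose base is not below \<open>g\<close> has empty preimage and is
  dropped.\<close>

lemma cone_filtration_saturate:
  fixes g :: "'n \<Rightarrow> nat"
  assumes "cone_filtration E L U" and E: "\<And>b. inf b g \<in> E \<longleftrightarrow> b \<in> E"
  shows "cone_filtration E (map (saturate g) (filter (\<lambda>p. fst p \<le> g) L)) {b. inf b g \<in> U}"
  using assms(1)
proof (induction rule: cone_filtration.induct)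
  case Nil
  then show ?case by (simp add: cone_filtration.Nil)
next
  case (snoc L U c Z)
  show ?case
  proof (cases "c \<le> g")
    case True
    let ?Z = "Z \<union> {j. c j = g j}"
    have eq: "{b. inf b g \<in> U \<union> cone c Z} = {b. inf b g \<in> U} \<union> cone c ?Z"
      using inf_in_cone_iff[OF True] by blast
    have "closed_in E {b. inf b g \<in> U \<union> cone c Z}"
      unfolding closed_in_def
    proof (intro conjI subsetI ballI allI impI)
      fix b assume "b \<in> {b. inf b g \<in> U \<union> cone c Z}"
      then have b: "inf b g \<in> U \<union> cone c Z" by simp
      then show "b \<in> E" using snoc.hyps(3) E by (auto simp: closed_in_def)
      fix v assume bv: "b + v \<in> E"
      \<comment> \<open>By monotonicity the truncated points also differ by a nonnegative exponent,
        so closedness of \<open>U \<union> cone c Z\<close> applies to them.\<close>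
      have "inf (b + v) g = inf b g + (inf (b + v) g - inf b g)"
        by (rule exp_le_add_diff) (auto simp: le_fun_def inf_fun_def inf_nat_def)
      then show "b + v \<in> {b. inf b g \<in> U \<union> cone c Z}"
        using snoc.hyps(3) E[of "b + v"] bv b unfolding closed_in_def by (metis mem_Collect_eq)
    qed
    then have closed: "closed_in E ({b. inf b g \<in> U} \<union> cone c ?Z)" by (simp only: eq)
    have "cone c ?Z \<inter> {b. inf b g \<in> U} = {}"
      using inf_in_cone_iff[OF True] snoc.hyps(2) by blast
    from cone_filtration.snoc[OF snoc.IH this closed] show ?thesis
      unfolding eq using True by (simp only: filter_append map_append) (simp add: saturate_def)
  next
    case False
    have "inf b g \<notin> cone c Z" for b
      using False order_trans[of c "inf b g" g] by (auto simp: cone_def)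
    then have "{b. inf b g \<in> U \<union> cone c Z} = {b. inf b g \<in> U}" by blast
    then show ?thesis using snoc.IH False
      by (simp only: filter_append map_append filter.simps list.map append_Nil2 fst_conv if_False)
  qed
qed

section \<open>From filtrations by cones to prime filtrations\<close>

locale monomial_quotient =
  fixes I J :: "('n::finite, 'k::field) mpoly set" and EI EJ :: "('n \<Rightarrow> nat) set"
  assumes I_eq: "I = supported EI" and J_eq: "J = supported EJ"
    and up_EI: "up_set EI" and up_EJ: "up_set EJ" and EJ_subset: "EJ \<subseteq> EI"
begin

abbreviation M where "M \<equiv> ideal_quot I J"
abbreviation \<pi> where "\<pi> x \<equiv> J +>\<^bsub>poly_gmodule\<^esub> x"
abbreviation E where "E \<equiv> EI - EJ"

sublocale presentation M \<pi> I J homogeneous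
  unfolding I_eq J_eq
  by (intro presentation_ideal_quot ideal_set_supported up_EI up_EJ supported_mono EJ_subset)

text \<open>A sum starting in \<open>U\<close> stays in \<open>EI\<close>, so it is in
  \<open>EJ\<close> or is caught by closedness. Thus \<open>EJ \<union> U\<close> is the exponent
  set of an ideal between \<open>J\<close> and \<open>I\<close>.\<close>

lemma up_set_Un:
  assumes U: "closed_in E U"
  shows "up_set (EJ \<union> U)"
  unfolding up_set_def
proof (intro ballI allI)
  fix v w assume "v \<in> EJ \<union> U"
  then consider "v \<in> EJ" | "v \<in> U" by blast
  then show "v + w \<in> EJ \<union> U"
  proof cases
    case 1
    then show ?thesis using up_EJ by (simp add: up_set_def)
  next
    case 2
    then have "v \<in> EI" using U by (auto simp: closed_in_def)
    then have "v + w \<in> EI" using up_EI by (simp add: up_set_def)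
    then show ?thesis using 2 U by (auto simp: closed_in_def)
  qed
qed

lemma ideal_set_Un: "closed_in E U \<Longrightarrow> ideal_set (supported (EJ \<union> U))"
  by (intro ideal_set_supported up_set_Un)

lemma supported_Un_subset: "closed_in E U \<Longrightarrow> supported (EJ \<union> U) \<subseteq> I"
  unfolding I_eq using EJ_subset by (intro supported_mono) (auto simp: closed_in_def)

lemma xpow_in_I: "xpow b \<in> I \<longleftrightarrow> b \<in> EI"
  by (simp add: I_eq xpow_in_supported)

text \<open>The difference of two distinct monomials has a nonzero coefficient at \<open>b\<close>,
  outside \<open>EJ\<close>, so it is not in \<open>J\<close>.\<close>

lemma inj_on_xpow: "inj_on (\<lambda>b. \<pi> (xpow b)) E"
proof (rule inj_onI)
  fix b c assume bc: "b \<in> E" "c \<in> E" "\<pi> (xpow b) = \<pi> (xpow c)"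
  then have "xpow b - xpow c \<in> J" by (subst (asm) eq_iff) (auto simp: xpow_in_I)
  then have "lookup (xpow b - xpow c :: ('n, 'k) mpoly) b = 0"
    using bc(1) unfolding J_eq supported_iff by blast
  then show "b = c"
    by (auto simp: xpow_def lookup_minus lookup_single when_def split: if_splits)
qed

text \<open>The homogeneous parts of \<open>f\<close> have their exponents among those of
  \<open>f\<close>, so they stay in the submodule.\<close>

lemma graded_submodule_supported:
  assumes "closed_in E U"
  shows "graded_submodule M (\<pi> ` supported (EJ \<union> U))"
  unfolding graded_submodule_def
proof (intro conjI ballI)
  show "submodule (\<pi> ` supported (EJ \<union> U)) mpoly_ring M"
    by (intro submodule_image ideal_set_Un supported_Un_subset assms)
  fix x assume "x \<in> \<pi> ` supported (EJ \<union> U)"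
  then obtain f where f: "f \<in> supported (EJ \<union> U)" "x = \<pi> f" by auto
  define A where "A = (\<lambda>v j. int (v j)) ` keys f"
  define y where "y a = poly_part {v. (\<lambda>j. int (v j)) = a} f" for a
  have y: "y a \<in> supported (EJ \<union> U)" "y a \<in> homogeneous a" for a
    using f(1) by (auto simp: y_def supported_def homogeneous_def keys_poly_part)
  then have yI: "y a \<in> I" for a using supported_Un_subset[OF assms] by blast
  have "f = sum y A"
  proof (rule poly_mapping_eqI)
    fix v
    have "lookup (sum y A) v = (\<Sum>a\<in>A. if (\<lambda>j. int (v j)) = a then lookup f v else 0)"
      unfolding lookup_sum y_def by (intro sum.cong) (auto simp: lookup_poly_part)
    also have "\<dots> = lookup f v"
      unfolding A_def by (auto simp: in_keys_iff)
    finally show "lookup f v = lookup (sum y A) v" by simp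
  qed
  then have x: "x = (\<Oplus>\<^bsub>M\<^esub>a\<in>A. \<pi> (y a))" using yI by (simp add: finsum_eq f(2))
  have "\<pi> (y a) \<in> hcomp M a \<inter> \<pi> ` supported (EJ \<union> U)" for a
    using y yI by (auto simp: hcomp_eq)
  with x show "\<exists>A y. finite A \<and> (\<forall>a\<in>A. y a \<in> hcomp M a \<inter> \<pi> ` supported (EJ \<union> U))
      \<and> x = (\<Oplus>\<^bsub>M\<^esub>a\<in>A. y a)"
    by (intro exI[of _ A] exI[of _ "\<lambda>a. \<pi> (y a)"]) (simp add: A_def)
qed

section \<open>One filtration step: the factor module obtained by adding a cone\<close>

context
  fixes U c Z
  assumes U: "closed_in E U" and U': "closed_in E (U \<union> cone c Z)" and disj: "cone c Z \<inter> U = {}"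
begin

abbreviation N where "N \<equiv> supported (EJ \<union> U) :: ('n, 'k) mpoly set"
abbreviation N' where "N' \<equiv> supported (EJ \<union> (U \<union> cone c Z)) :: ('n, 'k) mpoly set"

lemma cone_subset_X: "cone c Z \<subseteq> E"
  using U' by (auto simp: closed_in_def)

lemma step_presentation:
  "presentation (gquot (gsub M (\<pi> ` N')) (\<pi> ` N)) (\<lambda>x. \<pi> ` N +>\<^bsub>M\<^esub> \<pi> x) N' N homogeneous"
  by (intro subquotient ideal_set_Un U U' supported_Un_subset supported_mono)
    (auto simp: J_eq supported_mono)

lemma xpow_in_N': "xpow c \<in> N'"
  using self_in_cone by (auto simp: xpow_in_supported)

text \<open>The colon ideal of \<open>N\<close> by \<open>xpow c\<close>. Every \<open>v + c\<close>
  lies in the enlarged set, and in the new cone exactly for \<open>v \<in> exps Z\<close>; the cone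
  misses \<open>U\<close> and \<open>EJ\<close>. Membership is decided term by term, as
  multiplication by \<open>xpow c\<close> shifts exponents.\<close>

lemma step_ker: "r * xpow c \<in> N \<longleftrightarrow> r \<in> supported (- exps Z)"
proof -
  have "v + c \<in> EJ \<union> U \<longleftrightarrow> v \<notin> exps Z" for v
  proof -
    have "v + c \<in> cone c Z \<longleftrightarrow> v \<in> exps Z"
      unfolding cone_eq add.commute[of v c] by auto
    moreover have "v + c \<in> EJ \<union> (U \<union> cone c Z)"
      using up_set_Un[OF U'] self_in_cone[of c Z] by (auto simp: up_set_def add.commute)
    ultimately show ?thesis using disj cone_subset_X by blast
  qed
  then show ?thesis by (auto simp: supported_def keys_mult_xpow)
qed

text \<open>The terms of \<open>z\<close> in the cone form a multiple of \<open>xpow c\<close>, and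
  the others lie in \<open>N\<close>. The inclusion of keys keeps the multiple homogeneous when
  \<open>z\<close> is.\<close>

lemma step_factor:
  assumes "z \<in> N'"
  obtains r where "z - r * xpow c \<in> N" "keys (r * xpow c) \<subseteq> keys z"
proof -
  have "poly_part (cone c Z) z \<in> supported (cone c Z)"
    by (simp add: supported_def keys_poly_part)
  then obtain r where r: "poly_part (cone c Z) z = r * xpow c"
    by (rule supported_cone_factor)
  have "z - poly_part (cone c Z) z \<in> N"
    using assms by (auto simp: supported_iff lookup_minus lookup_poly_part split: if_splits)
  moreover have "keys (poly_part (cone c Z) z) \<subseteq> keys z" by (simp add: keys_poly_part)
  ultimately show ?thesis using that r by simp
qed

lemma step_giso:
  "giso (gquot (gsub M (\<pi> ` N')) (\<pi> ` N))
    (gshift (gquot poly_gmodule (supported (- exps Z))) (- (\<lambda>j. int (c j))))"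
\<comment> \<open>Multiplication by \<open>xpow c\<close> maps the ring onto \<open>N'\<close>
  modulo \<open>N\<close>. It raises multidegrees by \<open>c\<close>, which the shift by
  \<open>- c\<close> compensates.\<close>
proof (rule giso_presentation[where t = "\<lambda>r. r * xpow c"])
  show "presentation (gquot (gsub M (\<pi> ` N')) (\<pi> ` N)) (\<lambda>x. \<pi> ` N +>\<^bsub>M\<^esub> \<pi> x) N' N homogeneous"
    by (rule step_presentation)
  show "presentation (gshift (gquot poly_gmodule (supported (- exps Z))) (- (\<lambda>j. int (c j))))
      (\<lambda>x. supported (- exps Z) +>\<^bsub>poly_gmodule\<^esub> x) UNIV (supported (- exps Z))
      (\<lambda>b. homogeneous (- (\<lambda>j. int (c j)) + b))"
    by (intro presentation_gshift presentation_poly_quot ideal_set_supported up_set_non_exps)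
  show "y * xpow c \<in> N'" for y
    by (intro ideal_set_mult ideal_set_Un U' xpow_in_N')
  show "y * xpow c \<in> N \<longleftrightarrow> y \<in> supported (- exps Z)" for y by (rule step_ker)
  show "\<exists>y\<in>UNIV. z - y * xpow c \<in> N" if "z \<in> N'" for z
    using step_factor[OF that] by blast
  have shift: "r * xpow c \<in> homogeneous a \<longleftrightarrow> r \<in> homogeneous (- (\<lambda>j. int (c j)) + a)"
    for r :: "('n, 'k) mpoly" and a
    by (auto simp: homogeneous_def keys_mult_xpow fun_eq_iff algebra_simps)
  show "y * xpow c \<in> homogeneous a" if "y \<in> homogeneous (- (\<lambda>j. int (c j)) + a)"
    for a and y :: "('n, 'k) mpoly" using that shift by simp
  show "\<exists>y\<in>UNIV \<inter> homogeneous (- (\<lambda>j. int (c j)) + a). z - y * xpow c \<in> N"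
    if z: "z \<in> N'" "z \<in> homogeneous a" for a z
  proof -
    obtain r where r: "z - r * xpow c \<in> N" "keys (r * xpow c) \<subseteq> keys z" using step_factor[OF z(1)] .
    then have "r * xpow c \<in> homogeneous a" using z(2) by (auto simp: homogeneous_def)
    then show ?thesis using r(1) shift by blast
  qed
qed (simp_all add: algebra_simps)

lemma step_generated: "generated_by (gquot (gsub M (\<pi> ` N')) (\<pi> ` N)) (\<pi> ` N +>\<^bsub>M\<^esub> \<pi> (xpow c))"
proof -
  interpret Q: presentation "gquot (gsub M (\<pi> ` N')) (\<pi> ` N)" "\<lambda>x. \<pi> ` N +>\<^bsub>M\<^esub> \<pi> x" N' N homogeneous
    by (rule step_presentation)
  show ?thesis
    unfolding generated_by_def
  proof (intro conjI subset_antisym subsetI)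
    show "\<pi> ` N +>\<^bsub>M\<^esub> \<pi> (xpow c) \<in> carrier (gquot (gsub M (\<pi> ` N')) (\<pi> ` N))"
      unfolding Q.carrier_eq using xpow_in_N' by blast
    fix x assume "x \<in> carrier (gquot (gsub M (\<pi> ` N')) (\<pi> ` N))"
    then obtain z where z: "z \<in> N'" "x = \<pi> ` N +>\<^bsub>M\<^esub> \<pi> z" unfolding Q.carrier_eq by blast
    obtain r where r: "z - r * xpow c \<in> N" using step_factor[OF z(1)] .
    have "x = \<pi> ` N +>\<^bsub>M\<^esub> \<pi> (r * xpow c)"
      unfolding z(2) using Q.eq_iff[OF z(1) ideal_set_mult[OF Q.C xpow_in_N']] r by blast
    then show "x \<in> {r \<odot>\<^bsub>gquot (gsub M (\<pi> ` N')) (\<pi> ` N)\<^esub> (\<pi> ` N +>\<^bsub>M\<^esub> \<pi> (xpow c)) |r. True}"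
      using Q.smult_eq[OF xpow_in_N'] by blast
  next
    fix x assume "x \<in> {r \<odot>\<^bsub>gquot (gsub M (\<pi> ` N')) (\<pi> ` N)\<^esub> (\<pi> ` N +>\<^bsub>M\<^esub> \<pi> (xpow c)) |r. True}"
    then show "x \<in> carrier (gquot (gsub M (\<pi> ` N')) (\<pi> ` N))"
      using Q.smult_eq[OF xpow_in_N'] ideal_set_mult[OF Q.C xpow_in_N'] unfolding Q.carrier_eq by blast
  qed
qed

text \<open>The class of \<open>xpow c\<close> witnesses strictness: \<open>c\<close> lies outside
  \<open>EJ\<close> and \<open>U\<close>.\<close>

lemma step_psubset: "\<pi> ` N \<subset> \<pi> ` N'"
proof -
  have c: "c \<in> E" "c \<notin> U" using cone_subset_X self_in_cone[of c Z] disj by blast+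
  have "\<pi> (xpow c) \<noteq> \<pi> f" if "f \<in> N" for f
  proof
    assume "\<pi> (xpow c) = \<pi> f"
    then have "xpow c - f \<in> J"
      using eq_iff[of "xpow c" f] c that supported_Un_subset[OF U] xpow_in_I by blast
    then have "lookup (xpow c - f) c = 0" using c unfolding J_eq supported_iff by blast
    moreover have "lookup f c = 0" using that c unfolding supported_iff by blast
    ultimately show False by (simp add: lookup_minus xpow_def)
  qed
  then have "\<pi> (xpow c) \<notin> \<pi> ` N" by blast
  moreover have "\<pi> ` N \<subseteq> \<pi> ` N'" by (intro image_mono supported_mono) auto
  ultimately show ?thesis using xpow_in_N' by blast
qed

end

text \<open>The chain consists of the images of the ideals with exponent set \<open>EJ\<close>
  together with the first \<open>i\<close> cones; the results on a single step treat each
  factor.\<close>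

lemma induced_of_cone_filtration:
  assumes L: "cone_filtration E L E"
  shows "induced_by_prime_filtration M ((\<lambda>p. (\<pi> (xpow (fst p)), snd p)) ` set L)"
proof -
  define F where "F i = \<pi> ` supported (EJ \<union> cones (take i L))" for i
  define P where "P i = (supported (- exps (snd (L ! i))) :: ('n, 'k) mpoly set)" for i
  define a where "a i = (\<lambda>j. int (fst (L ! i) j))" for i
  define u where "u i = \<pi> (xpow (fst (L ! i)))" for i
  have closed: "closed_in E (cones (take i L))" if "i \<le> length L" for i
    using cone_filtration_closed[OF cone_filtration_take[OF L that]] .
  have U: "closed_in E (cones (take i L))"
      "closed_in E (cones (take i L) \<union> cone (fst (L ! i)) (snd (L ! i)))"
      "cone (fst (L ! i)) (snd (L ! i)) \<inter> cones (take i L) = {}"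
    and FS: "F (Suc i) = \<pi> ` supported (EJ \<union> (cones (take i L) \<union> cone (fst (L ! i)) (snd (L ! i))))"
    if "i < length L" for i
    using cone_filtration_nth[OF L that, of "fst (L ! i)" "snd (L ! i)"] by (simp_all add: F_def)
  have inL: "fst (L ! i) \<in> E" if "i < length L" for i
    using cone_subset_X[OF U[OF that]] self_in_cone by blast
  have "\<pi> ` supported EJ = {\<pi> 0}"
  proof -
    have "\<pi> f = \<pi> 0" if "f \<in> J" for f using eq_iff[of f 0] that K_subset ideal_set_zero[OF C] by auto
    then show ?thesis using ideal_set_zero[OF K] unfolding J_eq by blast
  qed
  then have F0: "F 0 = {\<zero>\<^bsub>M\<^esub>}" by (simp add: F_def cones_def zero_eq)
  have Fm: "F (length L) = carrier M"
  proof -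
    have "EJ \<union> cones L = EI" using cone_filtration_cones[OF L] EJ_subset by blast
    then show ?thesis unfolding F_def carrier_eq by (simp only: take_all order_refl I_eq)
  qed
  have filtration: "prime_filtration M (length L) F P a"
    unfolding prime_filtration_def
  proof (intro conjI allI impI)
    show "graded_submodule M (F i)" if "i \<le> length L" for i
      unfolding F_def by (rule graded_submodule_supported[OF closed[OF that]])
    show "F i \<subset> F (Suc i)" if "i < length L" for i
      unfolding FS[OF that] using step_psubset[OF U[OF that]] by (simp add: F_def)
    show "primeideal (P i) mpoly_ring" "monomial_ideal (P i)" for i
      unfolding P_def by (rule primeideal_non_exps monomial_ideal_non_exps)+
    show "giso (gquot (gsub M (F (Suc i))) (F i)) (gshift (gquot poly_gmodule (P i)) (- a i))"
      if "i < length L" for i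
      unfolding FS[OF that] P_def a_def using step_giso[OF U[OF that]] by (simp add: F_def)
  qed (rule F0 Fm)+
  have bij: "bij_betw (\<lambda>i. (u i, snd (L ! i))) {..<length L} ((\<lambda>p. (\<pi> (xpow (fst p)), snd p)) ` set L)"
    unfolding bij_betw_def
  proof
    show "inj_on (\<lambda>i. (u i, snd (L ! i))) {..<length L}"
    proof (rule inj_onI)
      fix i j assume ij: "i \<in> {..<length L}" "j \<in> {..<length L}" "(u i, snd (L ! i)) = (u j, snd (L ! j))"
      then have "fst (L ! i) = fst (L ! j)"
        using inL inj_on_xpow unfolding u_def by (auto dest: inj_onD)
      then have "L ! i = L ! j" using ij by (simp add: prod_eq_iff)
      then show "i = j"
        using ij cone_filtration_disjoint(1)[OF L] by (simp add: nth_eq_iff_index_eq)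
    qed
    show "(\<lambda>i. (u i, snd (L ! i))) ` {..<length L} = (\<lambda>p. (\<pi> (xpow (fst p)), snd p)) ` set L"
    proof -
      have "set L = (\<lambda>i. L ! i) ` {..<length L}" by (auto simp: set_conv_nth)
      then show ?thesis by (simp only: image_image u_def)
    qed
  qed
  have u_F: "u i \<in> F (Suc i)" if "i < length L" for i
    unfolding FS[OF that] u_def by (intro imageI xpow_in_N' U that)
  have u_hom: "u i \<in> hcomp M (a i)" if "i < length L" for i
    unfolding u_def a_def hcomp_eq
  proof (intro imageI IntI)
    show "xpow (fst (L ! i)) \<in> I" using inL[OF that] by (simp add: xpow_in_I)
    show "xpow (fst (L ! i)) \<in> homogeneous (\<lambda>j. int (fst (L ! i) j))"
      by (simp add: homogeneous_def xpow_def)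
  qed
  have gen: "generated_by (gquot (gsub M (F (Suc i))) (F i)) (F i +>\<^bsub>M\<^esub> u i)" if "i < length L" for i
    unfolding FS[OF that] u_def using step_generated[OF U[OF that]] by (simp add: F_def)
  have Z: "snd (L ! i) = {j. xvar j \<notin> P i}" for i
    by (auto simp: P_def xvar_in_non_exps_iff)
  show ?thesis
    unfolding induced_by_prime_filtration_def
  proof (intro exI conjI allI impI)
    show "prime_filtration M (length L) F P a" by (rule filtration)
    show "bij_betw (\<lambda>i. (u i, snd (L ! i))) {..<length L} ((\<lambda>p. (\<pi> (xpow (fst p)), snd p)) ` set L)"
      by (rule bij)
  qed (rule u_F u_hom gen Z, assumption?)+
qed

end

section \<open>From filtrations by cones to Stanley decompositions\<close>

context monomial_quotient
begin

text \<open>The spanning vectors are the classes of the monomials in the cone, so finite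
  combinations of them are the classes of polynomials supported on it.\<close>

lemma uK_eq:
  assumes "cone c Z \<subseteq> E"
  shows "uK M (\<pi> (xpow c)) Z = \<pi> ` supported (cone c Z)"
proof -
  have inI: "xpow b \<in> I" if "b \<in> cone c Z" for b
    using that assms by (auto simp: xpow_in_I)
  have gens: "{xpow v \<odot>\<^bsub>M\<^esub> \<pi> (xpow c) |v. v \<in> exps Z} = (\<lambda>b. \<pi> (xpow b)) ` cone c Z"
    using smult_eq[OF inI[OF self_in_cone]]
    by (auto simp: cone_eq xpow_mult_xpow add.commute)
  show ?thesis
    unfolding uK_def gens
  proof (intro subset_antisym subsetI)
    fix y assume "y \<in> K_span M ((\<lambda>b. \<pi> (xpow b)) ` cone c Z)"
    then obtain F k where F: "F \<subseteq> (\<lambda>b. \<pi> (xpow b)) ` cone c Z"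
      and y: "y = (\<Oplus>\<^bsub>M\<^esub>x\<in>F. scalar (k x) \<odot>\<^bsub>M\<^esub> x)" unfolding K_span_def by blast
    have "\<forall>x\<in>F. \<exists>b. b \<in> cone c Z \<and> x = \<pi> (xpow b)" using F by blast
    then obtain e where e: "\<And>x. x \<in> F \<Longrightarrow> e x \<in> cone c Z \<and> x = \<pi> (xpow (e x))"
      by (auto dest!: bchoice)
    have eI: "scalar (k x) * xpow (e x) \<in> I" if "x \<in> F" for x
      using e[OF that] inI ideal_set_mult[OF C] by blast
    have "y = (\<Oplus>\<^bsub>M\<^esub>x\<in>F. \<pi> (scalar (k x) * xpow (e x)))"
      unfolding y
    proof (rule abelian_monoid.finsum_cong')
      show "abelian_monoid M" using abelian_group by (simp add: abelian_group_def)
      show "(\<lambda>x. \<pi> (scalar (k x) * xpow (e x))) \<in> F \<rightarrow> carrier M"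
        using eI by (auto simp: carrier_eq)
      show "scalar (k x) \<odot>\<^bsub>M\<^esub> x = \<pi> (scalar (k x) * xpow (e x))" if "x \<in> F" for x
        using smult_eq[OF inI] e[OF that] by metis
    qed simp
    also have "\<dots> = \<pi> (\<Sum>x\<in>F. scalar (k x) * xpow (e x))" using eI by (rule finsum_eq)
    finally show "y \<in> \<pi> ` supported (cone c Z)"
      using e by (auto simp: single_eq_mult_xpow[symmetric] intro!: imageI sum_in_supported single_in_supported)
  next
    fix y assume "y \<in> \<pi> ` supported (cone c Z)"
    then obtain f where f: "f \<in> supported (cone c Z)" "y = \<pi> f" by auto
    define q where "q b = \<pi> (xpow b)" for b
    \<comment> \<open>\<open>K_span\<close> indexes coefficients by module elements, so the exponent
      has to be recovered from its class. This works since the cone lies in \<open>E\<close>, where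
      distinct monomials have distinct classes.\<close>
    define e where "e = the_inv_into (keys f) q"
    have keys: "keys f \<subseteq> cone c Z" using f by (simp add: supported_def)
    then have inj: "inj_on q (keys f)"
      using assms inj_on_xpow unfolding q_def by (meson inj_on_subset subset_trans)
    have e: "e (q b) = b" if "b \<in> keys f" for b
      unfolding e_def using inj that by (rule the_inv_into_f_f)
    define k where "k x = lookup f (e x)" for x
    have eI: "scalar (k x) * xpow (e x) \<in> I" if "x \<in> q ` keys f" for x
      using that e inI keys ideal_set_mult[OF C] by auto
    have "(\<Oplus>\<^bsub>M\<^esub>x\<in>q ` keys f. scalar (k x) \<odot>\<^bsub>M\<^esub> x) = (\<Oplus>\<^bsub>M\<^esub>x\<in>q ` keys f. \<pi> (scalar (k x) * xpow (e x)))"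
    proof (rule abelian_monoid.finsum_cong')
      show "abelian_monoid M" using abelian_group by (simp add: abelian_group_def)
      show "(\<lambda>x. \<pi> (scalar (k x) * xpow (e x))) \<in> q ` keys f \<rightarrow> carrier M"
        using eI unfolding carrier_eq by blast
      fix x assume "x \<in> q ` keys f"
      then obtain b where b: "b \<in> keys f" "x = q b" by blast
      then show "scalar (k x) \<odot>\<^bsub>M\<^esub> x = \<pi> (scalar (k x) * xpow (e x))"
        using smult_eq[OF inI] e keys unfolding q_def by auto
    qed simp
    also have "\<dots> = \<pi> (\<Sum>x\<in>q ` keys f. scalar (k x) * xpow (e x))" using eI by (rule finsum_eq)
    also have "(\<Sum>x\<in>q ` keys f. scalar (k x) * xpow (e x)) = f"
      unfolding sum.reindex[OF inj]
      by (subst (3) poly_eq_sum_keys) (auto simp: e k_def single_eq_mult_xpow intro!: sum.cong)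
    finally have "y = (\<Oplus>\<^bsub>M\<^esub>x\<in>q ` keys f. scalar (k x) \<odot>\<^bsub>M\<^esub> x)" using f(2) by simp
    moreover have "q ` keys f \<subseteq> (\<lambda>b. \<pi> (xpow b)) ` cone c Z" using keys unfolding q_def by blast
    moreover have "finite (q ` keys f)" by simp
    ultimately show "y \<in> K_span M ((\<lambda>b. \<pi> (xpow b)) ` cone c Z)"
      unfolding K_span_def by blast
  qed
qed

text \<open>If \<open>f\<close> in \<open>K[Z]\<close> kills the class of \<open>xpow c\<close>, the
  exponents of \<open>f * xpow c\<close> lie both in \<open>EJ\<close> and in the cone, which are
  disjoint.\<close>

lemma stanley_space_cone:
  assumes "cone c Z \<subseteq> E"
  shows "stanley_space M (\<pi> (xpow c)) Z"
  unfolding stanley_space_def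
proof (intro conjI ballI impI)
  have cI: "xpow c \<in> I" using assms self_in_cone by (auto simp: xpow_in_I)
  have "\<pi> (xpow c) \<in> hcomp M (\<lambda>j. int (c j))"
    unfolding hcomp_eq using cI by (intro imageI IntI) (auto simp: homogeneous_def xpow_def)
  then show "\<exists>a. \<pi> (xpow c) \<in> hcomp M a" by blast
  fix f :: "('n, 'k) mpoly" assume f: "f \<in> subpoly Z" "f \<odot>\<^bsub>M\<^esub> \<pi> (xpow c) = \<zero>\<^bsub>M\<^esub>"
  then have "\<pi> (f * xpow c) = \<pi> 0" by (simp only: smult_eq[OF cI] zero_eq)
  then have "f * xpow c \<in> J"
    using eq_iff[OF ideal_set_mult[OF C cI] ideal_set_zero[OF C]] by simp
  then have "(\<lambda>v. v + c) ` keys f \<subseteq> EJ" by (simp add: J_eq supported_def keys_mult_xpow)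
  moreover have "(\<lambda>v. v + c) ` keys f \<subseteq> cone c Z"
    using f(1) by (auto simp: subpoly_def cone_eq add.commute[of _ c])
  ultimately have "keys f = {}" using assms by blast
  then show "f = 0" by simp
qed

text \<open>The components are the projections onto the sets \<open>S p\<close>. They are unique, as
  a coefficient at an exponent in \<open>S p\<close> comes from the summand of \<open>p\<close>
  alone and elements of \<open>J\<close> vanish there.\<close>

lemma direct_sum:
  assumes fin: "finite D" and disj: "\<And>p q. p \<in> D \<Longrightarrow> q \<in> D \<Longrightarrow> p \<noteq> q \<Longrightarrow> S p \<inter> S q = {}"
    and un: "(\<Union>p\<in>D. S p) = E" and f: "f \<in> I"
  shows "\<exists>!w. w \<in> (\<Pi>\<^sub>E p\<in>D. \<pi> ` supported (S p)) \<and> \<pi> f = (\<Oplus>\<^bsub>M\<^esub>p\<in>D. w p)"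
proof -
  have inI: "y \<in> I" if "p \<in> D" "y \<in> supported (S p)" for p y
    using that un unfolding I_eq supported_def by blast
  have lookup_eq: "lookup (\<Sum>p\<in>D. y p) v = lookup (y p0) v"
    if y: "\<And>p. p \<in> D \<Longrightarrow> y p \<in> supported (S p)" and v: "v \<in> S p0" "p0 \<in> D" for y p0 v
  proof -
    have "lookup (y p) v = 0" if "p \<in> D" "p \<noteq> p0" for p
      using y[OF that(1)] disj[OF that(1) v(2) that(2)] v(1) unfolding supported_iff by blast
    then have "(\<Sum>p\<in>D. lookup (y p) v) = (\<Sum>p\<in>D. if p = p0 then lookup (y p0) v else 0)"
      by (intro sum.cong) auto
    then show ?thesis using fin v(2) by (simp add: lookup_sum)
  qed
  show ?thesis
  proof (rule ex_ex1I)
    let ?y = "\<lambda>p. poly_part (S p) f"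
    let ?w = "\<lambda>p\<in>D. \<pi> (?y p)"
    have y: "?y p \<in> supported (S p)" for p by (simp add: supported_def keys_poly_part)
    have "f - (\<Sum>p\<in>D. ?y p) \<in> J"
      unfolding J_eq supported_iff
    proof (intro allI impI)
      fix v assume v: "lookup (f - (\<Sum>p\<in>D. ?y p)) v \<noteq> 0"
      show "v \<in> EJ"
      proof (rule ccontr)
        assume "v \<notin> EJ"
        have "v \<in> EI"
        proof (rule ccontr)
          assume nv: "v \<notin> EI"
          have "(\<Sum>p\<in>D. ?y p) \<in> I" using inI y by (intro ideal_set_sum[OF C]) blast
          then have "f - (\<Sum>p\<in>D. ?y p) \<in> I" by (intro ideal_set_diff[OF C] f)
          then show False using v nv unfolding I_eq supported_iff by blast
        qed
        then obtain p where p: "p \<in> D" "v \<in> S p" using un \<open>v \<notin> EJ\<close> by blast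
        have "lookup (\<Sum>p\<in>D. ?y p) v = lookup f v"
          using lookup_eq[of ?y v p] y p by (simp add: lookup_poly_part)
        then show False using v by (simp add: lookup_minus)
      qed
    qed
    then have eq: "\<pi> f = \<pi> (\<Sum>p\<in>D. ?y p)"
      using inI y f by (subst eq_iff) (auto intro: ideal_set_sum[OF C])
    have "(\<Oplus>\<^bsub>M\<^esub>p\<in>D. ?w p) = (\<Oplus>\<^bsub>M\<^esub>p\<in>D. \<pi> (?y p))"
    proof (rule abelian_monoid.finsum_cong')
      show "abelian_monoid M" using abelian_group by (simp add: abelian_group_def)
      show "(\<lambda>p. \<pi> (?y p)) \<in> D \<rightarrow> carrier M" unfolding carrier_eq using inI y by blast
    qed simp_all
    also have "\<dots> = \<pi> f" unfolding eq using inI y by (intro finsum_eq) blast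
    finally have "\<pi> f = (\<Oplus>\<^bsub>M\<^esub>p\<in>D. ?w p)" by simp
    moreover have "?w \<in> (\<Pi>\<^sub>E p\<in>D. \<pi> ` supported (S p))" using y by (intro restrict_PiE_iff[THEN iffD2]) blast
    ultimately show "\<exists>w. w \<in> (\<Pi>\<^sub>E p\<in>D. \<pi> ` supported (S p)) \<and> \<pi> f = (\<Oplus>\<^bsub>M\<^esub>p\<in>D. w p)" by blast
  next
    fix w w' assume w: "w \<in> (\<Pi>\<^sub>E p\<in>D. \<pi> ` supported (S p)) \<and> \<pi> f = (\<Oplus>\<^bsub>M\<^esub>p\<in>D. w p)"
      and w': "w' \<in> (\<Pi>\<^sub>E p\<in>D. \<pi> ` supported (S p)) \<and> \<pi> f = (\<Oplus>\<^bsub>M\<^esub>p\<in>D. w' p)"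
    \<comment> \<open>Coefficients can only be compared on polynomials, so the components are first
      lifted to polynomials with the prescribed supports.\<close>
    have lift: "\<exists>y. (\<forall>p\<in>D. y p \<in> supported (S p) \<and> u p = \<pi> (y p)) \<and> \<pi> f = \<pi> (\<Sum>p\<in>D. y p)"
      if u: "u \<in> (\<Pi>\<^sub>E p\<in>D. \<pi> ` supported (S p))" "\<pi> f = (\<Oplus>\<^bsub>M\<^esub>p\<in>D. u p)" for u
    proof -
      have "\<forall>p\<in>D. \<exists>y. y \<in> supported (S p) \<and> u p = \<pi> y" using u(1) by (fastforce dest: PiE_mem)
      then obtain y where y: "\<And>p. p \<in> D \<Longrightarrow> y p \<in> supported (S p) \<and> u p = \<pi> (y p)"
        by (auto dest!: bchoice)
      have "(\<Oplus>\<^bsub>M\<^esub>p\<in>D. u p) = (\<Oplus>\<^bsub>M\<^esub>p\<in>D. \<pi> (y p))"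
      proof (rule abelian_monoid.finsum_cong')
        show "abelian_monoid M" using abelian_group by (simp add: abelian_group_def)
        show "(\<lambda>p. \<pi> (y p)) \<in> D \<rightarrow> carrier M" unfolding carrier_eq using inI y by blast
      qed (use y in auto)
      also have "\<dots> = \<pi> (\<Sum>p\<in>D. y p)" using inI y by (intro finsum_eq) blast
      finally show ?thesis using u(2) y by auto
    qed
    from w obtain y where y: "\<And>p. p \<in> D \<Longrightarrow> y p \<in> supported (S p) \<and> w p = \<pi> (y p)"
      "\<pi> f = \<pi> (\<Sum>p\<in>D. y p)" using lift[of w] by blast
    from w' obtain y' where y': "\<And>p. p \<in> D \<Longrightarrow> y' p \<in> supported (S p) \<and> w' p = \<pi> (y' p)"
      "\<pi> f = \<pi> (\<Sum>p\<in>D. y' p)" using lift[of w'] by blast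
    have "(\<Sum>p\<in>D. y p) \<in> I" "(\<Sum>p\<in>D. y' p) \<in> I"
      using y(1) y'(1) inI by (auto intro!: ideal_set_sum[OF C])
    then have J: "(\<Sum>p\<in>D. y p) - (\<Sum>p\<in>D. y' p) \<in> J" using y(2) y'(2) eq_iff by metis
    have "y p = y' p" if p: "p \<in> D" for p
    proof (rule poly_mapping_eqI)
      fix v
      show "lookup (y p) v = lookup (y' p) v"
      proof (cases "v \<in> S p")
        case True
        then have "v \<notin> EJ" using un p by blast
        then have "lookup ((\<Sum>p\<in>D. y p) - (\<Sum>p\<in>D. y' p)) v = 0"
          using J unfolding J_eq supported_iff by blast
        then show ?thesis
          using lookup_eq[of y v p] lookup_eq[of y' v p] y(1) y'(1) True p by (simp add: lookup_minus)
      next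
        case False
        then show ?thesis using y(1)[OF p] y'(1)[OF p] unfolding supported_iff by metis
      qed
    qed
    then show "w = w'" using w w' y(1) y'(1) by (intro PiE_ext[of w D _ w']) auto
  qed
qed

lemma stanley_decomposition_of_cone_filtration:
  assumes L: "cone_filtration E L E"
  shows "stanley_decomposition M ((\<lambda>p. (\<pi> (xpow (fst p)), snd p)) ` set L)"
proof -
  let ?\<phi> = "\<lambda>p. (\<pi> (xpow (fst p)), snd p)"
  let ?D = "?\<phi> ` set L"
  have E: "E = cones L" using cone_filtration_cones[OF L] .
  have cone_E: "cone (fst p) (snd p) \<subseteq> E" if "p \<in> set L" for p
    using that unfolding E cones_def by auto
  have inj: "inj_on ?\<phi> (set L)"
  proof (rule inj_onI)
    fix p q assume pq: "p \<in> set L" "q \<in> set L" "?\<phi> p = ?\<phi> q"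
    then have "\<pi> (xpow (fst p)) = \<pi> (xpow (fst q))" by (simp only: prod.inject)
    moreover have "fst p \<in> E" "fst q \<in> E"
      using cone_E[OF pq(1)] cone_E[OF pq(2)] self_in_cone by blast+
    ultimately have "fst p = fst q" by (rule inj_onD[OF inj_on_xpow])
    then show "p = q" using pq(3) by (simp add: prod_eq_iff)
  qed
  \<comment> \<open>\<open>e\<close> recovers the base exponent from its class, so that the cone
    \<open>S p\<close> can be indexed by the summands themselves.\<close>
  define e where "e = inv_into (set L) ?\<phi>"
  have e_inv: "e (?\<phi> p) = p" if "p \<in> set L" for p
    unfolding e_def using inj that by (rule inv_into_f_f)
  have e: "e p \<in> set L" "?\<phi> (e p) = p" if "p \<in> ?D" for p
    unfolding e_def using that by (rule inv_into_into, rule f_inv_into_f)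
  define S where "S p = cone (fst (e p)) (snd (e p))" for p
  have uK: "uK M (fst p) (snd p) = \<pi> ` supported (S p)" if "p \<in> ?D" for p
    
  proof -
    have "fst p = \<pi> (xpow (fst (e p)))" "snd p = snd (e p)"
      using arg_cong[OF e(2)[OF that], of fst] arg_cong[OF e(2)[OF that], of snd] by simp_all
    then show ?thesis unfolding S_def using uK_eq[OF cone_E[OF e(1)[OF that]]] by simp
  qed
  have "stanley_space M u Z \<and> uK M u Z \<subseteq> carrier M" if "(u, Z) \<in> ?D" for u Z
  proof
    show "stanley_space M u Z"
      using that stanley_space_cone[OF cone_E] by auto
    have "supported (S (u, Z)) \<subseteq> I"
      unfolding S_def I_eq using cone_E[OF e(1)[OF that]] by (intro supported_mono) blast
    then show "uK M u Z \<subseteq> carrier M"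
      using uK[OF that] unfolding carrier_eq by auto
  qed
  moreover have "\<exists>!w. w \<in> (\<Pi>\<^sub>E p\<in>?D. uK M (fst p) (snd p)) \<and> x = (\<Oplus>\<^bsub>M\<^esub>p\<in>?D. w p)"
    if x: "x \<in> carrier M" for x
  proof -
    obtain f where f: "f \<in> I" "x = \<pi> f" using x unfolding carrier_eq by blast
    have "(\<Pi>\<^sub>E p\<in>?D. uK M (fst p) (snd p)) = (\<Pi>\<^sub>E p\<in>?D. \<pi> ` supported (S p))"
      using uK by (intro PiE_cong) auto
    moreover have "\<exists>!w. w \<in> (\<Pi>\<^sub>E p\<in>?D. \<pi> ` supported (S p)) \<and> \<pi> f = (\<Oplus>\<^bsub>M\<^esub>p\<in>?D. w p)"
    proof (rule direct_sum)
      show "S p \<inter> S q = {}" if "p \<in> ?D" "q \<in> ?D" "p \<noteq> q" for p q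
      proof -
        have "e p \<noteq> e q" using e(2)[OF that(1)] e(2)[OF that(2)] that(3) by metis
        then show ?thesis
          unfolding S_def by (intro cone_filtration_disjoint(2)[OF L] e(1) that)
      qed
      have "(\<Union>p\<in>?D. S p) = (\<Union>p\<in>set L. cone (fst p) (snd p))"
        unfolding S_def by (simp add: e_inv)
      then show "(\<Union>p\<in>?D. S p) = E" unfolding E cones_def by (simp add: case_prod_beta)
    qed (use f in auto)
    ultimately show ?thesis unfolding f(2) by (simp only:)
  qed
  ultimately show ?thesis
    unfolding stanley_decomposition_def by auto
qed

end

section \<open>From prime filtrations to filtrations by cones\<close>

text \<open>A multidegree determines the exponent, so graded components of the ring have dimension
  at most one.\<close>

lemma homogeneous_single:
  assumes "z \<in> homogeneous a" "z \<noteq> 0"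
  obtains c k where "z = Poly_Mapping.single c k" "k \<noteq> 0"
proof -
  from assms(2) have "keys z \<noteq> {}" by simp
  then obtain c where c: "c \<in> keys z" by blast
  have "v = c" if "v \<in> keys z" for v
  proof -
    have "(\<lambda>j. int (v j)) = (\<lambda>j. int (c j))" using assms(1) c that by (simp add: homogeneous_def)
    then show ?thesis by (simp add: fun_eq_iff)
  qed
  then have "keys z = {c}" using c by blast
  then have "z = Poly_Mapping.single c (lookup z c)" using poly_eq_sum_keys[of z] by simp
  moreover have "lookup z c \<noteq> 0" using c by (simp add: in_keys_iff)
  ultimately show ?thesis by (rule that)
qed

lemma ideal_set_single_iff:
  assumes "ideal_set C" "k \<noteq> 0"
  shows "Poly_Mapping.single b k \<in> C \<longleftrightarrow> (xpow b :: ('n, 'k::field) mpoly) \<in> C"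
proof
  assume "Poly_Mapping.single b k \<in> C"
  from ideal_set_mult[OF assms(1) this, of "scalar (inverse k)"] assms(2)
  show "xpow b \<in> C" by (simp add: scalar_def xpow_def mult_single)
next
  assume "(xpow b :: ('n, 'k) mpoly) \<in> C"
  then show "Poly_Mapping.single b k \<in> C"
    unfolding single_eq_mult_xpow by (rule ideal_set_mult[OF assms(1)])
qed

text \<open>The generator goes to the class of some \<open>t\<close> outside \<open>P\<close>, and
  by primality \<open>r * t\<close> is in \<open>P\<close> exactly when \<open>r\<close> is. This
  identifies the annihilator of \<open>z\<close> modulo \<open>N\<close>.\<close>

lemma cyclic_quotient_annihilator:
  assumes "presentation Q q N' N H" "presentation T p UNIV P H'"
    and iso: "giso Q T" and P: "primeideal P mpoly_ring"
    and z: "z \<in> N'" and gen: "generated_by Q (q z)"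
  shows "r * z \<in> N \<longleftrightarrow> r \<in> P" and "x \<in> N' \<Longrightarrow> \<exists>r. x - r * z \<in> N"
proof -
  interpret Q: presentation Q q N' N H by fact
  interpret T: presentation T p UNIV P H' by fact
  interpret P: primeideal P mpoly_ring by fact
  have one: "1 \<notin> P"
    using P.I_notcarr ideal_set_mult[OF T.K, of 1] by auto
  have prime: "x * y \<in> P \<Longrightarrow> x \<in> P \<or> y \<in> P" for x y
    using P.I_prime[of x y] by simp
  have rz: "r * z \<in> N'" for r by (rule ideal_set_mult[OF Q.C z])
  have gen_eq: "\<exists>r. y = q (r * z)" if "y \<in> carrier Q" for y
    using gen that Q.smult_eq[OF z] by (auto simp: generated_by_def)
  show "\<exists>r. x - r * z \<in> N" if "x \<in> N'" for x
    using gen_eq[of "q x"] Q.eq_iff[OF that rz] that by (auto simp: Q.carrier_eq)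
  obtain h where h: "bij_betw h (carrier Q) (carrier T)"
    and h_smult: "\<forall>r. \<forall>x\<in>carrier Q. h (r \<odot>\<^bsub>Q\<^esub> x) = r \<odot>\<^bsub>T\<^esub> h x"
    using iso unfolding giso_def by blast
  have q_in: "q x \<in> carrier Q" if "x \<in> N'" for x using that by (simp add: Q.carrier_eq)
  have "h (q z) \<in> carrier T" using bij_betwE[OF h] q_in[OF z] by blast
  then obtain t where t: "h (q z) = p t" by (auto simp: T.carrier_eq)
  have h_mult: "h (q (r * z)) = p (r * t)" for r
    using h_smult q_in[OF z] Q.smult_eq[OF z, of r] T.smult_eq[OF UNIV_I, of r t] t by metis
  \<comment> \<open>The image of a generator generates the ring modulo \<open>P\<close>, so some
    \<open>r * t\<close> is congruent to 1, which is impossible for \<open>t\<close> in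
    \<open>P\<close>.\<close>
  have "t \<notin> P"
  proof
    assume "t \<in> P"
    have "p 1 \<in> carrier T" by (simp add: T.carrier_eq)
    then obtain y where "y \<in> carrier Q" "h y = p 1" using bij_betw_imp_surj_on[OF h] by (metis imageE)
    then obtain r where "p (r * t) = p 1" using gen_eq h_mult by metis
    then have "r * t - 1 \<in> P" by (simp add: T.eq_iff)
    from ideal_set_diff[OF T.K ideal_set_mult[OF T.K \<open>t \<in> P\<close>, of r] this]
    show False using one by simp
  qed
  \<comment> \<open>Zero is written as \<open>0 * z\<close> so that \<open>h_mult\<close> evaluates
    both sides.\<close>
  have "r * z \<in> N \<longleftrightarrow> q (r * z) = q (0 * z)"
    using Q.eq_iff[OF rz rz, of r 0] by simp
  also have "\<dots> \<longleftrightarrow> h (q (r * z)) = h (q (0 * z))"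
    using bij_betw_imp_inj_on[OF h] q_in[OF rz] by (metis inj_onD)
  also have "\<dots> \<longleftrightarrow> r * t \<in> P"
    unfolding h_mult using T.eq_iff[of "r * t" "0 * t"] by simp
  also have "\<dots> \<longleftrightarrow> r \<in> P"
    using prime[of r t] \<open>t \<notin> P\<close> ideal_set_mult[OF T.K, of r t] by (auto simp: mult.commute)
  finally show "r * z \<in> N \<longleftrightarrow> r \<in> P" .
qed

context monomial_quotient
begin

section \<open>Exponent sets of graded submodules\<close>

definition preimage where "preimage F = {x\<in>I. \<pi> x \<in> F}"
definition exps_of where "exps_of F = {b\<in>E. \<pi> (xpow b) \<in> F}"

text \<open>Gradedness makes the preimage of \<open>F\<close> monomial modulo \<open>J\<close>: a
  term of \<open>x\<close> outside \<open>J\<close> occurs in a homogeneous summand lying in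
  \<open>F\<close>, and the lift of that summand is a single term.\<close>

lemma graded_preimage:
  assumes F: "graded_submodule M F" and x: "x \<in> preimage F" and b: "b \<in> keys x" "b \<notin> EJ"
  shows "b \<in> exps_of F"
proof -
  have sub: "submodule F mpoly_ring M" using F by (simp add: graded_submodule_def)
  note N = submodule_preimage[OF sub, folded preimage_def]
  have xI: "x \<in> I" and "\<pi> x \<in> F" using x by (simp_all add: preimage_def)
  then obtain A y where A: "finite A" "\<forall>a\<in>A. y a \<in> hcomp M a \<inter> F" "\<pi> x = (\<Oplus>\<^bsub>M\<^esub>a\<in>A. y a)"
    using F unfolding graded_submodule_def by metis
  have "\<forall>a\<in>A. \<exists>z. z \<in> I \<inter> homogeneous a \<and> y a = \<pi> z" using A(2) unfolding hcomp_eq by blast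
  from bchoice[OF this] obtain z where z: "\<forall>a\<in>A. z a \<in> I \<inter> homogeneous a \<and> y a = \<pi> (z a)" ..
  have zI: "z a \<in> I" if "a \<in> A" for a using z that by blast
  have "\<pi> x = (\<Oplus>\<^bsub>M\<^esub>a\<in>A. \<pi> (z a))"
    unfolding A(3)
  proof (rule abelian_monoid.finsum_cong')
    show "abelian_monoid M" using abelian_group by (simp add: abelian_group_def)
    show "(\<lambda>p. \<pi> (z p)) \<in> A \<rightarrow> carrier M" unfolding carrier_eq using zI by blast
  qed (use z in auto)
  also have "\<dots> = \<pi> (sum z A)" using zI by (rule finsum_eq)
  finally have "x - sum z A \<in> J" by (simp only: eq_iff[OF xI ideal_set_sum[OF C zI]])
  then have "lookup (x - sum z A) b = 0" using b(2) unfolding J_eq supported_iff by blast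
  then have "lookup (sum z A) b \<noteq> 0" using b(1) by (simp add: lookup_minus in_keys_iff)
  then obtain a where a: "a \<in> A" "lookup (z a) b \<noteq> 0"
    unfolding lookup_sum by (meson sum.not_neutral_contains_not_neutral)
  then have "z a \<noteq> 0" by auto
  then obtain c k where ck: "z a = Poly_Mapping.single c k" "k \<noteq> 0"
    using homogeneous_single z a(1) by blast
  then have "c = b" using a(2) by (auto simp: lookup_single when_def split: if_splits)
  have "z a \<in> preimage F" using z A(2) a(1) zI by (auto simp: preimage_def)
  then have "xpow b \<in> preimage F"
    using ideal_set_single_iff[OF N(1) ck(2)] unfolding ck(1) \<open>c = b\<close> by blast
  then show ?thesis
    using b(2) by (auto simp: preimage_def exps_of_def xpow_in_I)
qed

lemma closed_in_exps_of:
  assumes "submodule F mpoly_ring M"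
  shows "closed_in E (exps_of F)"
proof -
  note N = submodule_preimage[OF assms, folded preimage_def]
  have "b + v \<in> exps_of F" if "b \<in> exps_of F" "b + v \<in> E" for b v
  proof -
    have "xpow b \<in> preimage F" using that by (auto simp: exps_of_def preimage_def xpow_in_I)
    from ideal_set_mult[OF N(1) this, of "xpow v"] that(2) show ?thesis
      by (simp add: xpow_mult_xpow add.commute preimage_def exps_of_def)
  qed
  then show ?thesis by (auto simp: closed_in_def exps_of_def)
qed

text \<open>The generator has a homogeneous representative, a scalar multiple of some
  \<open>xpow c\<close>. As its annihilator is \<open>P\<close>, the exponents in the cone at
  \<open>c\<close> are new, and generation shows that no others are.\<close>

lemma filtration_step:
  assumes F: "graded_submodule M F" and F': "graded_submodule M F'" and sub: "F \<subseteq> F'"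
    and P: "primeideal P mpoly_ring"
    and iso: "giso (gquot (gsub M F') F) (gshift (gquot poly_gmodule P) s)"
    and u: "u \<in> F'" "u \<in> hcomp M a"
    and gen: "generated_by (gquot (gsub M F') F) (F +>\<^bsub>M\<^esub> u)"
  obtains c where "exps_of F' = exps_of F \<union> cone c {j. xvar j \<notin> P}"
    "cone c {j. xvar j \<notin> P} \<inter> exps_of F = {}"
proof -
  define Z where "Z = {j. (xvar j :: ('n, 'k) mpoly) \<notin> P}"
  define N N' where "N = preimage F" and "N' = preimage F'"
  have sF: "submodule F mpoly_ring M" and sF': "submodule F' mpoly_ring M"
    using F F' by (simp_all add: graded_submodule_def)
  note N = submodule_preimage[OF sF, folded preimage_def, folded N_def]
  note N' = submodule_preimage[OF sF', folded preimage_def, folded N'_def]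
  have NN': "N \<subseteq> N'" using sub by (auto simp: N_def N'_def preimage_def)
  have N'I: "N' \<subseteq> I" by (auto simp: N'_def preimage_def)
  interpret P: primeideal P "mpoly_ring :: ('n, 'k) mpoly ring" by fact
  have P_ideal: "ideal_set P" using P.is_ideal by (simp add: ideal_iff_ideal_set)
  have one: "1 \<notin> P"
    using P.I_notcarr ideal_set_mult[OF P_ideal, of 1] by auto
  have Q: "presentation (gquot (gsub M F') F) (\<lambda>x. F +>\<^bsub>M\<^esub> \<pi> x) N' N homogeneous"
    using subquotient[OF N(1) N'(1) N(2) NN' N'I] unfolding N(3) N'(3) .
  have T: "presentation (gshift (gquot poly_gmodule P) s) (\<lambda>x. P +>\<^bsub>poly_gmodule\<^esub> x) UNIV P
      (\<lambda>b. homogeneous (s + b))"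
    by (intro presentation_gshift presentation_poly_quot P_ideal)
  obtain z where z: "z \<in> I" "z \<in> homogeneous a" "u = \<pi> z" using u(2) unfolding hcomp_eq by blast
  have zN': "z \<in> N'" using z u(1) by (simp add: N'_def preimage_def)
  note ann = cyclic_quotient_annihilator[OF Q T iso P zN' gen[unfolded z(3)]]
  note mem_iff = ann(1)
  have rz: "r * z \<in> N'" for r by (rule ideal_set_mult[OF N'(1) zN'])
  have "z \<noteq> 0"
    using mem_iff[of 1] one ideal_set_zero[OF N(1)] by auto
  then obtain c k where ck: "z = Poly_Mapping.single c k" "k \<noteq> 0"
    using homogeneous_single[OF z(2)] by blast
  have xz: "xpow v * z = Poly_Mapping.single (c + v) k" for v
    by (simp add: ck(1) xpow_def mult_single add.commute)
  have in_N: "xpow (c + v) \<in> N \<longleftrightarrow> v \<notin> exps Z" for v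
    using mem_iff[of "xpow v"] unfolding xz ideal_set_single_iff[OF N(1) ck(2)]
      xpow_in_prime_iff[OF P] Z_def .
  have in_N': "xpow (c + v) \<in> N'" for v
    using rz[of "xpow v"] unfolding xz ideal_set_single_iff[OF N'(1) ck(2)] .
  have exps_iff: "b \<in> exps_of F \<longleftrightarrow> xpow b \<in> N \<and> b \<notin> EJ" for b
    by (auto simp: exps_of_def N_def preimage_def xpow_in_I)
  have exps_iff': "b \<in> exps_of F' \<longleftrightarrow> xpow b \<in> N' \<and> b \<notin> EJ" for b
    by (auto simp: exps_of_def N'_def preimage_def xpow_in_I)
  have EJ_N: "xpow b \<in> N" if "b \<in> EJ" for b
    using that N(2) by (auto simp: J_eq xpow_in_supported)
  have cone: "b \<in> exps_of F'" "b \<notin> exps_of F" if b: "b \<in> cone c Z" for b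
  proof -
    obtain v where v: "v \<in> exps Z" "b = c + v" using b unfolding cone_eq by blast
    then have n: "xpow b \<notin> N" using in_N by blast
    then show "b \<notin> exps_of F" by (simp add: exps_iff)
    show "b \<in> exps_of F'" using n EJ_N in_N' v(2) unfolding exps_iff' by blast
  qed
  \<comment> \<open>A monomial of \<open>N'\<close> is congruent to some \<open>r * z\<close> modulo
    \<open>N\<close>. If \<open>b\<close> occurs in \<open>r * z\<close>, then
    \<open>b = v + c\<close>, with \<open>v \<in> exps Z\<close> as the monomial is not in
    \<open>N\<close>; otherwise \<open>b\<close> survives in the difference and
    \<open>graded_preimage\<close> applies.\<close>
  have "b \<in> exps_of F \<union> cone c Z" if b: "b \<in> exps_of F'" for b
  proof (rule ccontr)
    assume nb: "b \<notin> exps_of F \<union> cone c Z"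
    have bN': "xpow b \<in> N'" and bJ: "b \<notin> EJ" using b by (simp_all add: exps_iff')
    obtain r where diff: "xpow b - r * z \<in> N" using ann(2)[OF bN'] by (rule exE)
    show False
    proof (cases "b \<in> keys (r * z)")
      case True
      then obtain v where v: "b = v + c"
        using keys_mult[of r z] by (auto simp: ck(1) split: if_splits)
      then have "xpow b \<notin> N"
        using nb bJ by (auto simp: exps_iff)
      then have "v \<in> exps Z" using in_N[of v] v by (auto simp: add.commute)
      then have "b \<in> cone c Z" unfolding cone_eq v by (intro image_eqI[of _ _ v]) (simp_all add: add.commute)
      then show False using nb by blast
    next
      case False
      then have "b \<in> keys (xpow b - r * z)"
        by (simp add: in_keys_iff lookup_minus xpow_def)
      then have "b \<in> exps_of F" using graded_preimage[OF F] diff bJ unfolding N_def by blast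
      then show False using nb by blast
    qed
  qed
  moreover have "exps_of F \<subseteq> exps_of F'" using sub by (auto simp: exps_of_def)
  ultimately have "exps_of F' = exps_of F \<union> cone c Z" using cone by blast
  moreover have "cone c Z \<inter> exps_of F = {}" using cone by blast
  ultimately show ?thesis using that unfolding Z_def by blast
qed

text \<open>Applying \<open>exps_of\<close> to the chain gives the initial unions of cones. Only the
  sets \<open>Z\<close> are compared with \<open>D\<close>, which is all that \<open>sdepth\<close>
  sees.\<close>

lemma cone_filtration_of_induced:
  assumes "induced_by_prime_filtration M D"
  obtains L where "cone_filtration E L E" "snd ` set L \<subseteq> snd ` D" "finite D"
proof -
  from assms obtain m F P a u Z where filt: "prime_filtration M m F P a"
    and bij: "bij_betw (\<lambda>i. (u i, Z i)) {..<m} D"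
    and step: "\<forall>i<m. u i \<in> F (Suc i) \<and> u i \<in> hcomp M (a i)
          \<and> generated_by (gquot (gsub M (F (Suc i))) (F i)) (F i +>\<^bsub>M\<^esub> u i)
          \<and> Z i = {j. xvar j \<notin> P i}"
    unfolding induced_by_prime_filtration_def by blast
  have grad: "graded_submodule M (F i)" if "i \<le> m" for i
    using filt that by (simp add: prime_filtration_def)
  have "\<forall>i\<in>{..<m}. \<exists>c. exps_of (F (Suc i)) = exps_of (F i) \<union> cone c (Z i)
      \<and> cone c (Z i) \<inter> exps_of (F i) = {}"
  proof
    fix i assume "i \<in> {..<m}"
    then have i: "i < m" by simp
    then have f: "F i \<subseteq> F (Suc i)" "primeideal (P i) mpoly_ring"
      "giso (gquot (gsub M (F (Suc i))) (F i)) (gshift (gquot poly_gmodule (P i)) (- a i))"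
      using filt unfolding prime_filtration_def by blast+
    have st: "u i \<in> F (Suc i)" "u i \<in> hcomp M (a i)"
      "generated_by (gquot (gsub M (F (Suc i))) (F i)) (F i +>\<^bsub>M\<^esub> u i)"
      "Z i = {j. xvar j \<notin> P i}" using step i by blast+
    have g: "graded_submodule M (F i)" "graded_submodule M (F (Suc i))" using grad i by simp_all
    obtain c where "exps_of (F (Suc i)) = exps_of (F i) \<union> cone c {j. xvar j \<notin> P i}"
      "cone c {j. xvar j \<notin> P i} \<inter> exps_of (F i) = {}"
      using filtration_step[OF g f st(1-3)] .
    then show "\<exists>c. exps_of (F (Suc i)) = exps_of (F i) \<union> cone c (Z i)
      \<and> cone c (Z i) \<inter> exps_of (F i) = {}" unfolding st(4) by blast
  qed
  from bchoice[OF this] obtain c where c: "\<forall>i\<in>{..<m}. exps_of (F (Suc i)) = exps_of (F i) \<union> cone (c i) (Z i)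
      \<and> cone (c i) (Z i) \<inter> exps_of (F i) = {}" ..
  define L where "L k = map (\<lambda>i. (c i, Z i)) [0..<k]" for k
  have L: "cone_filtration E (L k) (exps_of (F k))" if "k \<le> m" for k
    using that
  proof (induction k)
    case 0
    have F0: "F 0 = {\<pi> 0}" using filt by (simp add: prime_filtration_def zero_eq)
    have "\<pi> (xpow b) \<noteq> \<pi> 0" if "b \<in> E" for b
      using that eq_iff[of "xpow b" 0] ideal_set_zero[OF C]
      by (simp add: xpow_in_I J_eq xpow_in_supported)
    then have "exps_of (F 0) = {}" unfolding F0 exps_of_def by blast
    then show ?case by (simp add: L_def cone_filtration.Nil)
  next
    case (Suc k)
    then have IH: "cone_filtration E (L k) (exps_of (F k))" by simp
    have ck: "exps_of (F (Suc k)) = exps_of (F k) \<union> cone (c k) (Z k)"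
      "cone (c k) (Z k) \<inter> exps_of (F k) = {}"
      using c Suc.prems by auto
    have "closed_in E (exps_of (F (Suc k)))"
      using closed_in_exps_of grad[OF Suc.prems] unfolding graded_submodule_def by blast
    then have "closed_in E (exps_of (F k) \<union> cone (c k) (Z k))" unfolding ck(1) .
    from cone_filtration.snoc[OF IH ck(2) this] show ?case by (simp add: L_def ck(1))
  qed
  have "F m = carrier M" using filt by (simp add: prime_filtration_def)
  then have "exps_of (F m) = E" by (auto simp: exps_of_def carrier_eq xpow_in_I)
  then have "cone_filtration E (L m) E" using L[of m] by simp
  moreover have "snd ` set (L m) \<subseteq> snd ` D"
    unfolding bij_betw_imp_surj_on[OF bij, symmetric] L_def by (simp add: image_image atLeast0LessThan)
  moreover have "finite D" using bij_betw_finite[OF bij] by simp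
  ultimately show ?thesis by (rule that)
qed

end

section \<open>Interval partitions\<close>

lemma sdepth_mono:
  assumes "finite D" "finite D'" "D' \<noteq> {}" "\<And>Z'. Z' \<in> snd ` D' \<Longrightarrow> \<exists>Z\<in>snd ` D. card Z \<le> card Z'"
  shows "sdepth D \<le> sdepth D'"
proof -
  have "sdepth D' \<in> (\<lambda>(u, Z). card Z) ` D'"
    unfolding sdepth_def using assms(2,3) by (intro Min_in) auto
  then obtain u' Z' where Z': "(u', Z') \<in> D'" "sdepth D' = card Z'" by auto
  then obtain u Z where Z: "(u, Z) \<in> D" "card Z \<le> card Z'" using assms(4)[of Z'] by force
  have "sdepth D \<le> card Z"
    unfolding sdepth_def using assms(1) Z(1) by (intro Min_le) force+
  then show ?thesis using Z Z' by simp
qed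

text \<open>For \<open>c \<le> g\<close> the upper end is the largest element of the cone below
  \<open>g\<close>.\<close>

definition interval_of :: "('n \<Rightarrow> nat) \<Rightarrow> ('n \<Rightarrow> nat) \<times> 'n set \<Rightarrow> ('n \<Rightarrow> nat) \<times> ('n \<Rightarrow> nat)" where
  "interval_of g = (\<lambda>(c, Z). (c, \<lambda>j. if j \<in> Z then g j else c j))"

text \<open>The upper end agrees with \<open>g\<close> exactly on \<open>Z\<close> and where
  \<open>c\<close> already does. This matches the summands of the partition with the enlarged
  cones.\<close>

lemma Zset_interval_of: "Zset g (snd (interval_of g p)) = snd (saturate g p)"
  by (cases p) (auto simp: Zset_def interval_of_def saturate_def)

lemma interval_of_eq_cone:
  assumes "fst p \<le> g"
  shows "{fst (interval_of g p)..snd (interval_of g p)} = {b \<in> cone (fst p) (snd p). b \<le> g}"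
proof -
  obtain c Z where p: "p = (c, Z)" by (cases p)
  have "(c j \<le> b j \<and> b j \<le> (if j \<in> Z then g j else c j))
      \<longleftrightarrow> ((c j \<le> b j \<and> (j \<notin> Z \<longrightarrow> b j = c j)) \<and> b j \<le> g j)" for b :: "'a \<Rightarrow> nat" and j
    using assms le_funD[of c g j] by (auto simp: p)
  then have "(\<forall>j. c j \<le> b j \<and> b j \<le> (if j \<in> Z then g j else c j))
      \<longleftrightarrow> (\<forall>j. (c j \<le> b j \<and> (j \<notin> Z \<longrightarrow> b j = c j)) \<and> b j \<le> g j)" for b :: "'a \<Rightarrow> nat"
    by (simp only:)
  then show ?thesis
    unfolding p interval_of_def cone_def
    by (simp only: set_eq_iff prod.case fst_conv snd_conv atLeastAtMost_iff mem_Collect_eq le_fun_def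
        all_conj_distrib simp_thms)
qed

text \<open>Each interval contributes a single Stanley space: an admissible point agrees with
  \<open>c\<close> on \<open>Zset\<close> by definition, and outside \<open>Z\<close> the two ends
  of the interval coincide.\<close>

lemma partition_decomposition_intervals:
  fixes L :: "(('n \<Rightarrow> nat) \<times> 'n set) list"
  assumes "\<And>p. p \<in> set L \<Longrightarrow> fst p \<le> g"
  shows "partition_decomposition J g (interval_of g ` set L)
    = (\<lambda>p. (J +>\<^bsub>poly_gmodule\<^esub> xpow (fst p), snd p)) ` set (map (saturate g) L)"
proof -
  have base: "c' = c"
    if "(c, Z) \<in> set L" "c' \<in> {c..(\<lambda>j. if j \<in> Z then g j else c j)}"
      "\<forall>j\<in>Zset g (\<lambda>j. if j \<in> Z then g j else c j). c' j = c j" for c c' :: "'n \<Rightarrow> nat" and Z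
  proof
    fix j
    show "c' j = c j"
    proof (cases "j \<in> Z")
      case True
      then show ?thesis using that(3) by (simp add: Zset_def)
    next
      case False
      have "c j \<le> c' j" "c' j \<le> (if j \<in> Z then g j else c j)"
        using that(2) by (auto simp: le_fun_def)
      then show ?thesis using False by simp
    qed
  qed
  show ?thesis
  proof (intro subset_antisym subsetI)
    fix x assume "x \<in> partition_decomposition J g (interval_of g ` set L)"
    then obtain c' e d where x: "x = (J +>\<^bsub>poly_gmodule\<^esub> xpow c', Zset g d)"
      "(e, d) \<in> interval_of g ` set L" "c' \<in> {e..d}" "\<forall>j\<in>Zset g d. c' j = e j"
      unfolding partition_decomposition_def by blast
    then obtain p where p: "p \<in> set L" "interval_of g p = (e, d)" by (metis imageE)
    obtain c Z where cZ: "p = (c, Z)" by (cases p)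
    have "c' = c" using base[of c Z c'] p x(3,4) unfolding cZ interval_of_def by auto
    then have "x = (J +>\<^bsub>poly_gmodule\<^esub> xpow (fst (saturate g p)), snd (saturate g p))"
      using x(1) p(2) Zset_interval_of[of g p] by (simp add: cZ saturate_def)
    then show "x \<in> (\<lambda>p. (J +>\<^bsub>poly_gmodule\<^esub> xpow (fst p), snd p)) ` set (map (saturate g) L)"
      using p(1) by simp
  next
    fix x assume "x \<in> (\<lambda>p. (J +>\<^bsub>poly_gmodule\<^esub> xpow (fst p), snd p)) ` set (map (saturate g) L)"
    then obtain p where p: "p \<in> set L"
      "x = (J +>\<^bsub>poly_gmodule\<^esub> xpow (fst (saturate g p)), snd (saturate g p))" by auto
    obtain c Z where cZ: "p = (c, Z)" by (cases p)
    let ?d = "\<lambda>j. if j \<in> Z then g j else c j"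
    have "c \<in> {c..?d}" using assms[OF p(1)] by (auto simp: cZ le_fun_def)
    moreover have "(c, ?d) \<in> interval_of g ` set L"
      using p(1) cZ by (force simp: interval_of_def)
    moreover have "x = (J +>\<^bsub>poly_gmodule\<^esub> xpow c, Zset g ?d)"
      using p(2) Zset_interval_of[of g p] by (simp add: cZ saturate_def interval_of_def)
    ultimately show "x \<in> partition_decomposition J g (interval_of g ` set L)"
      unfolding partition_decomposition_def by blast
  qed
qed

text \<open>The cones partition \<open>E\<close>, so their traces on the box below \<open>g\<close>
  partition the poset. A cone meets the box only if its base is below \<open>g\<close>, and then in
  an interval.\<close>

lemma interval_partition_cones:
  assumes L: "cone_filtration E L E"
  shows "interval_partition {b \<in> E. b \<le> g} (interval_of g ` {p \<in> set L. fst p \<le> g})"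
  unfolding interval_partition_def
proof (intro conjI)
  let ?K = "{p \<in> set L. fst p \<le> g}"
  let ?P = "{b \<in> E. b \<le> g}"
  have E: "E = (\<Union>p\<in>set L. cone (fst p) (snd p))"
    using cone_filtration_cones[OF L] by (simp add: cones_def case_prod_beta)
  have int: "{c..d} \<inter> ?P = {c..d}" "{c..d} = {b \<in> cone (fst p) (snd p). b \<le> g}"
    if "p \<in> ?K" "interval_of g p = (c, d)" for p c d
  proof -
    show eq: "{c..d} = {b \<in> cone (fst p) (snd p). b \<le> g}"
      using interval_of_eq_cone[of p g] that by simp
    show "{c..d} \<inter> ?P = {c..d}" unfolding eq using that(1) E by blast
  qed
  show "finite (interval_of g ` ?K)" by simp
  show "\<forall>(c, d)\<in>interval_of g ` ?K. c \<in> ?P \<and> d \<in> ?P \<and> c \<le> d"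
  proof safe
    fix c d p assume p: "(c, d) = interval_of g p" "p \<in> set L" "fst p \<le> g"
    then have "c = fst p" "d = (\<lambda>j. if j \<in> snd p then g j else fst p j)"
      by (simp_all add: interval_of_def case_prod_beta)
    then show "c \<le> d" using le_funD[OF p(3)] by (simp add: le_fun_def)
    then have "c \<in> {c..d}" "d \<in> {c..d}" by simp_all
    then show "c \<in> E" "c \<le> g" "d \<in> E" "d \<le> g" using int[of p c d] p by auto
  qed
  show "disjoint_family_on (\<lambda>(c, d). {c..d} \<inter> ?P) (interval_of g ` ?K)"
    unfolding disjoint_family_on_def
  proof (intro ballI impI)
    fix x y assume "x \<in> interval_of g ` ?K" "y \<in> interval_of g ` ?K" and ne: "x \<noteq> y"
    then obtain p q where p: "p \<in> ?K" "x = interval_of g p" and q: "q \<in> ?K" "y = interval_of g q"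
      by blast
    have "p \<noteq> q" using ne p(2) q(2) by blast
    then have "cone (fst p) (snd p) \<inter> cone (fst q) (snd q) = {}"
      using p(1) q(1) by (intro cone_filtration_disjoint(2)[OF L]) auto
    moreover have sub: "(case interval_of g r of (c, d) \<Rightarrow> {c..d} \<inter> ?P) \<subseteq> cone (fst r) (snd r)"
      if "r \<in> ?K" for r
      using int(2)[OF that, of "fst (interval_of g r)" "snd (interval_of g r)"] by (auto simp: case_prod_beta)
    ultimately show "(case x of (c, d) \<Rightarrow> {c..d} \<inter> ?P) \<inter> (case y of (c, d) \<Rightarrow> {c..d} \<inter> ?P) = {}"
      unfolding p(2) q(2) using Int_mono[OF sub[OF p(1)] sub[OF q(1)]] by (simp only: subset_empty)
  qed
  show "?P = (\<Union>(c, d)\<in>interval_of g ` ?K. {c..d} \<inter> ?P)"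
  proof (intro subset_antisym subsetI)
    fix b assume b: "b \<in> ?P"
    then obtain p where p: "p \<in> set L" "b \<in> cone (fst p) (snd p)" using E by blast
    then have "fst p \<le> b" by (simp add: cone_def)
    then have "fst p \<le> g" using b by (auto intro: order_trans)
    then have pK: "p \<in> ?K" using p by simp
    moreover have "b \<in> {fst (interval_of g p)..snd (interval_of g p)} \<inter> ?P"
      using int[OF pK, of "fst (interval_of g p)" "snd (interval_of g p)"] p b by simp
    ultimately show "b \<in> (\<Union>(c, d)\<in>interval_of g ` ?K. {c..d} \<inter> ?P)"
      by (intro UN_I[of "interval_of g p"]) (auto simp: case_prod_beta)
  qed auto
qed

theorem theorem2p7:
  fixes I J :: "('n::finite, 'k::field) mpoly set"
    and A B :: "('n \<Rightarrow> nat) set"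
    and g :: "'n \<Rightarrow> nat"
    and D :: "(('n, 'k) mpoly set \<times> 'n set) set"
  assumes "finite A" and "finite B"
    and "I = Idl\<^bsub>mpoly_ring\<^esub> (xpow ` A)"
    and "J = Idl\<^bsub>mpoly_ring\<^esub> (xpow ` B)"
    and "J \<subset> I"
    and "\<forall>a\<in>A. a \<le> g" and "\<forall>b\<in>B. b \<le> g"
    and "stanley_decomposition (ideal_quot I J) D"
    and "induced_by_prime_filtration (ideal_quot I J) D"
  shows "\<exists>Q. interval_partition (char_poset A B g) Q
    \<and> stanley_decomposition (ideal_quot I J) (partition_decomposition J g Q)
    \<and> induced_by_prime_filtration (ideal_quot I J) (partition_decomposition J g Q)
    \<and> sdepth (partition_decomposition J g Q) \<ge> sdepth D"
proof -
  define EI EJ where "EI = {b. \<exists>a\<in>A. a \<le> b}" and "EJ = {b. \<exists>a\<in>B. a \<le> b}"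
  have I: "I = supported EI" and J: "J = supported EJ"
    unfolding EI_def EJ_def assms(3,4) by (rule genideal_eq_supported)+
  have up: "up_set {b. \<exists>a\<in>S. a \<le> b}" for S :: "('n \<Rightarrow> nat) set"
    by (auto simp: up_set_def le_fun_def intro: trans_le_add1)
  have sub: "EJ \<subseteq> EI"
  proof
    fix b assume "b \<in> EJ"
    then have "(xpow b :: ('n, 'k) mpoly) \<in> J" by (simp add: J xpow_in_supported)
    then have "(xpow b :: ('n, 'k) mpoly) \<in> I" using assms(5) by blast
    then show "b \<in> EI" by (simp add: I xpow_in_supported)
  qed
  interpret monomial_quotient I J EI EJ
    by standard (use I J up sub in \<open>auto simp: EI_def EJ_def\<close>)
  \<comment> \<open>All generators are below \<open>g\<close>, so \<open>a \<le> inf b g\<close> and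
    \<open>a \<le> b\<close> are equivalent for each generator \<open>a\<close>.\<close>
  have E_inf: "inf b g \<in> E \<longleftrightarrow> b \<in> E" for b
    using assms(6,7) by (auto simp: EI_def EJ_def)
  have poset: "char_poset A B g = {b \<in> E. b \<le> g}"
    by (auto simp: char_poset_def EI_def EJ_def)
  obtain L where L: "cone_filtration E L E" "snd ` set L \<subseteq> snd ` D" "finite D"
    using cone_filtration_of_induced[OF assms(9)] .
  define K where "K = filter (\<lambda>p. fst p \<le> g) L"
  define Q where "Q = interval_of g ` set K"
  let ?D = "partition_decomposition J g Q"
  have filt: "cone_filtration E (map (saturate g) K) E"
  proof -
    have "{b. inf b g \<in> E} = E" using E_inf by blast
    then show ?thesis using cone_filtration_saturate[OF L(1) E_inf] by (simp only: K_def)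
  qed
  have D: "?D = (\<lambda>p. (\<pi> (xpow (fst p)), snd p)) ` set (map (saturate g) K)"
    unfolding Q_def by (rule partition_decomposition_intervals) (simp add: K_def)
  have "interval_partition (char_poset A B g) Q"
    using interval_partition_cones[OF L(1), of g] by (simp add: poset Q_def K_def)
  moreover have "stanley_decomposition M ?D" "induced_by_prime_filtration M ?D"
    unfolding D by (rule stanley_decomposition_of_cone_filtration[OF filt] induced_of_cone_filtration[OF filt])+
  moreover have "sdepth D \<le> sdepth ?D"
  proof (rule sdepth_mono)
    \<comment> \<open>\<open>sdepth\<close> is a minimum, so the new decomposition has to be
      nonempty; this comes from \<open>J\<close> being strictly smaller than
      \<open>I\<close>.\<close>
    have "EI \<noteq> EJ" using assms(5) I J by auto
    then have "E \<noteq> {}" using sub by blast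
    then have "K \<noteq> []" using cone_filtration_cones[OF filt] by (auto simp: cones_def)
    then show "?D \<noteq> {}" unfolding D by simp
    show "finite ?D" unfolding D by simp
    show "\<exists>Z\<in>snd ` D. card Z \<le> card Z'" if Z': "Z' \<in> snd ` ?D" for Z'
    proof -
      obtain p where p: "p \<in> set K" "Z' = snd (saturate g p)" using Z' unfolding D by auto
      then have "snd p \<in> snd ` D" using L(2) by (auto simp: K_def)
      \<comment> \<open>Each enlarged cone comes from a summand of \<open>D\<close>, and enlarging
        \<open>Z\<close> does not lower its cardinality.\<close>
      moreover have "card (snd p) \<le> card Z'"
        unfolding p(2) saturate_def by (intro card_mono) (auto simp: case_prod_beta)
      ultimately show ?thesis by blast
    qed
  qed (rule L(3))
  ultimately show ?thesis by blast
qed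

end
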